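(* Let $x=x(t)$ for $t\ge t_0$, with $x(t_0)=x_0$, be a single-valued continuous curve along which the entropy solution $u$ is discontinuous, i.e. $u(x(t)+,t)<u(x(t)-,t)$ for any $t>t_0$. Then $x=x(t)$ is the forward generalized characteristic of $(x_0,t_0)$, which can be described by the triangle sequence $\{\Delta_I(x(t),t)\}$ and a unique triangle sequence $\{\Delta_{J_n}(x(t),t)\}$ with $J_n\subset\mathcal{U}^c(x(t),t)$ as $$\Delta_I(x_0,t_0)\subset\Delta_I(x(t_1),t_1)\subset\Delta_I(x(t_2),t_2)\quad\text{for any }t_2>t_1>t_0,$$ $$\Delta_{J_n}(x_0,t_0)\subset\Delta_{J_n}(x(t_1),t_1)\subset\Delta_{J_n}(x(t_2),t_2)\quad\text{for any }t_2>t_1>t_0.$$ Furthermore, the curve $x=x(t)$, $t\ge t_0$, is a Lipschitz continuous shock such that: (i) For any $t>t_0$, $x=x(t)$ is differentiable from the right, and $$\frac{d^+x(t)}{dt}:=\lim_{t'\to t+}\frac{x(t')-x(t)}{t'-t}=\frac{f(u(x(t)-,t))-f(u(x(t)+,t))}{u(x(t)-,t)-u(x(t)+,t)}.$$ (ii) For any $t>t_0$, $x=x(t)$ is differentiable from the left, and $$\frac{d^-x(t)}{dt}:=\lim_{t'\to t-}\frac{x(t')-x(t)}{t'-t}=\frac{f(d_n)-f(c_n)}{d_n-c_n}$$ for the $J_n=(c_n,d_n)\subset\mathcal{U}^c(x(t),t)$ such that $(x(\tau),\tau)\in\Delta_{J_n}(x(t),t)$ on $[t_0,t)$. (iii) Except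 for at most countably many $t>t_0$, $\frac{d^+x(t)}{dt}=\frac{d^-x(t)}{dt}$.
   Context: Setting: $f\in C^2(\mathbb{R})$, $f''\ge0$, $\mathcal{L}\{f''=0\}=0$ ($\mathcal L$ Lebesgue measure), so $f'$ is strictly increasing; $\varphi\in L^\infty(\mathbb{R})$. For $t>0$: $E(u;x,t)=t\int_0^u f''(s)(\varphi(x-tf'(s))-s)\,ds$; $\mathcal{U}(x,t)$ is the (nonempty compact) set of maximizers of $E(\cdot\,;x,t)$. The entropy solution of $u_t+f(u)_x=0$, $u|_{t=0}=\varphi$ is $u(x,t)=\inf\mathcal{U}(x,t)$, with traces $u(x-,t)=\sup\mathcal{U}(x,t)$, $u(x+,t)=\inf\mathcal{U}(x,t)$. Points $(x_0,t_0)$ are taken in the open upper half-plane, $t_0>0$. For $t>0$: $I=I(x,t)=[u(x+,t),u(x-,t)]$; $\mathcal{U}^c(x,t)=I\setminus\mathcal{U}(x,t)=\bigcup_nJ_n$ with $J_n=(c_n,d_n)$ its (at most countably many, disjoint) component open intervals; $l_v(x,t)=\{(\xi,\tau): \xi=x+(\tau-t)f'(v),\ \tau\in(0,t)\}$; $\Delta_G(x,t)=\bigcup_{v\in G}l_v(x,t)$ for $G\subset\mathbb{R}$ (so $\Delta_I(x,t)$ is the backward characteristic triangle from $(x,t)$, and $\Delta_{J_n}(x,t)$ the sub-triangle belonging to a component $J_n$ of $\mathcal{U}^c(x,t)$). Forward generalized characteristic of $(x_0,t_0)$: the unique curve $x=x(t)$, $t\ge t_0$, $x(t_0)=x_0$,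 with $\Delta_I(x_0,t_0)\subset\Delta_I(x(t_1),t_1)\subset\Delta_I(x(t_2),t_2)$ for all $t_2>t_1>t_0$. *)

theory Defs
  imports "HOL-Analysis.Analysis"
begin

text \<open>Throughout, \<open>f\<close> is the flux and \<open>\<phi>\<close> the initial datum of
  \<open>u\<^sub>t + f(u)\<^sub>x = 0\<close>, \<open>u(\<cdot>,0) = \<phi>\<close>. The integral is taken against the completed measure
  because \<open>\<phi>\<close> is only assumed Lebesgue measurable.\<close>

definition E :: "(real \<Rightarrow> real) \<Rightarrow> (real \<Rightarrow> real) \<Rightarrow> real \<Rightarrow> real \<Rightarrow> real \<Rightarrow> real" where
  "E f \<phi> u x t =
     t * (LINT s=0..u|lebesgue. (deriv (deriv f) s * (\<phi> (x - t * deriv f s) - s)))"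

definition maximizers :: "(real \<Rightarrow> real) \<Rightarrow> (real \<Rightarrow> real) \<Rightarrow> real \<Rightarrow> real \<Rightarrow> real set" where
  "maximizers f \<phi> x t = {u. \<forall>v. E f \<phi> v x t \<le> E f \<phi> u x t}"

text \<open>The traces \<open>u(x-,t)\<close> and \<open>u(x+,t)\<close> of the entropy solution
  \<open>u(x,t) = Inf (maximizers f \<phi> x t)\<close>. Since \<open>f'\<close> is strictly increasing, shocks jump downwards
  and the left trace is the larger one.\<close>

definition entropy_solution :: "(real \<Rightarrow> real) \<Rightarrow> (real \<Rightarrow> real) \<Rightarrow> real \<Rightarrow> real \<Rightarrow> real" where
  "entropy_solution f \<phi> x t = Inf (maximizers f \<phi> x t)"

definition trace_left :: "(real \<Rightarrow> real) \<Rightarrow> (real \<Rightarrow> real) \<Rightarrow> real \<Rightarrow> real \<Rightarrow> real" where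
  "trace_left f \<phi> x t = Sup (maximizers f \<phi> x t)"

definition trace_right :: "(real \<Rightarrow> real) \<Rightarrow> (real \<Rightarrow> real) \<Rightarrow> real \<Rightarrow> real \<Rightarrow> real" where
  "trace_right f \<phi> x t = entropy_solution f \<phi> x t"

definition state_interval :: "(real \<Rightarrow> real) \<Rightarrow> (real \<Rightarrow> real) \<Rightarrow> real \<Rightarrow> real \<Rightarrow> real set" where
  "state_interval f \<phi> x t = {trace_right f \<phi> x t..trace_left f \<phi> x t}"

text \<open>The complement of the maximizers in the state interval is open; its component intervals
  \<open>J\<^sub>n = (c\<^sub>n, d\<^sub>n)\<close> are the elements of \<open>components (gaps f \<phi> x t)\<close>.\<close>

definition gaps :: "(real \<Rightarrow> real) \<Rightarrow> (real \<Rightarrow> real) \<Rightarrow> real \<Rightarrow> real \<Rightarrow> real set" where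
  "gaps f \<phi> x t = state_interval f \<phi> x t - maximizers f \<phi> x t"

definition char_line :: "(real \<Rightarrow> real) \<Rightarrow> real \<Rightarrow> real \<Rightarrow> real \<Rightarrow> (real \<times> real) set" where
  "char_line f v x t = {(\<xi>, \<tau>). \<xi> = x + (\<tau> - t) * deriv f v \<and> \<tau> \<in> {0<..<t}}"

definition back_triangle :: "(real \<Rightarrow> real) \<Rightarrow> real set \<Rightarrow> real \<Rightarrow> real \<Rightarrow> (real \<times> real) set" where
  "back_triangle f G x t = (\<Union>v\<in>G. char_line f v x t)"

definition char_triangle ::
  "(real \<Rightarrow> real) \<Rightarrow> (real \<Rightarrow> real) \<Rightarrow> real \<Rightarrow> real \<Rightarrow> (real \<times> real) set" where
  "char_triangle f \<phi> x t = back_triangle f (state_interval f \<phi> x t) x t"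

definition nested_char_triangles ::
  "(real \<Rightarrow> real) \<Rightarrow> (real \<Rightarrow> real) \<Rightarrow> real \<Rightarrow> real \<Rightarrow> (real \<Rightarrow> real) \<Rightarrow> bool" where
  "nested_char_triangles f \<phi> x0 t0 x \<longleftrightarrow> x t0 = x0 \<and>
     (\<forall>t1 t2. t0 < t1 \<and> t1 < t2 \<longrightarrow>
        char_triangle f \<phi> x0 t0 \<subseteq> char_triangle f \<phi> (x t1) t1 \<and>
        char_triangle f \<phi> (x t1) t1 \<subseteq> char_triangle f \<phi> (x t2) t2)"

text \<open>Curves are total functions here, so that uniqueness can only be asked for on
  \<open>[t0, \<infinity>)\<close>.\<close>

definition forward_generalized_characteristic ::
  "(real \<Rightarrow> real) \<Rightarrow> (real \<Rightarrow> real) \<Rightarrow> real \<Rightarrow> real \<Rightarrow> (real \<Rightarrow> real) \<Rightarrow> bool" where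
  "forward_generalized_characteristic f \<phi> x0 t0 x \<longleftrightarrow>
     nested_char_triangles f \<phi> x0 t0 x \<and>
     (\<forall>y. nested_char_triangles f \<phi> x0 t0 y \<longrightarrow> (\<forall>t\<ge>t0. y t = x t))"

text \<open>A nested choice of one gap component \<open>J t\<close> for each \<open>t > t0\<close>. The initial time is left out
  because \<open>gaps f \<phi> (x t0) t0\<close> may have no component at all (if the solution is continuous at the
  initial point) or several of them (if several shocks meet there).\<close>

definition nested_gap_triangles ::
  "(real \<Rightarrow> real) \<Rightarrow> (real \<Rightarrow> real) \<Rightarrow> real \<Rightarrow> (real \<Rightarrow> real) \<Rightarrow> (real \<Rightarrow> real set) \<Rightarrow> bool" where
  "nested_gap_triangles f \<phi> t0 x J \<longleftrightarrow>
     (\<forall>t>t0. J t \<in> components (gaps f \<phi> (x t) t)) \<and>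
     (\<forall>t1 t2. t0 < t1 \<and> t1 < t2 \<longrightarrow>
        back_triangle f (J t1) (x t1) t1 \<subseteq> back_triangle f (J t2) (x t2) t2)"

definition contains_past ::
  "(real \<Rightarrow> real) \<Rightarrow> (real \<Rightarrow> real) \<Rightarrow> real \<Rightarrow> (real \<Rightarrow> real) \<Rightarrow> real \<Rightarrow> real set \<Rightarrow> bool" where
  "contains_past f \<phi> t0 x t G \<longleftrightarrow> G \<in> components (gaps f \<phi> (x t) t) \<and>
     (\<forall>\<tau>\<in>{t0..<t}. (x \<tau>, \<tau>) \<in> back_triangle f G (x t) t)"

definition discontinuous_along ::
  "(real \<Rightarrow> real) \<Rightarrow> (real \<Rightarrow> real) \<Rightarrow> real \<Rightarrow> (real \<Rightarrow> real) \<Rightarrow> bool" where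
  "discontinuous_along f \<phi> t0 x \<longleftrightarrow> (\<forall>t>t0. trace_right f \<phi> (x t) t < trace_left f \<phi> (x t) t)"

definition lipschitz_shock ::
  "(real \<Rightarrow> real) \<Rightarrow> (real \<Rightarrow> real) \<Rightarrow> real \<Rightarrow> (real \<Rightarrow> real) \<Rightarrow> bool" where
  "lipschitz_shock f \<phi> t0 x \<longleftrightarrow>
     (\<exists>L. L-lipschitz_on {t0..} x) \<and> discontinuous_along f \<phi> t0 x"

end

theory Submission
  imports Defs
begin

text \<open>Substituting \<open>y = x - t f'(s)\<close> turns \<open>E\<close> into a constant minus the Lax--Oleinik cost
  \<open>\<Phi>(x - t f'(u)) + t (u f'(u) - f(u))\<close>, where \<open>\<Phi>\<close> is a primitive of \<open>\<phi>\<close>. Strict convexity makes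
  the minimizer unique along every open backward characteristic of a minimizer, so these
  characteristics never cross, and a curve of jumps can never meet one of them.
  Hence the curve cannot leave the backward triangles of its later points, and
  the slope of the chord back to an earlier point never belongs to a minimizer; this
  selects one gap \<open>(c, d)\<close>.
  The one-sided derivatives come from the expansion \<open>\<Delta>V = u \<Delta>x - f(u) \<Delta>t + o\<close> of the value
  function along minimizers tending to \<open>u\<close>: on the right it applies with the two traces, on the left
  with \<open>c\<close> and \<open>d\<close>, and comparing the two expansions gives the Rankine--Hugoniot slope.\<close>

subsection \<open>The cost function\<close>

text \<open>A nondecreasing function that is not strictly increasing is constant on some interval,
  so its derivative vanishes on a nonempty open set, and such a set is not negligible.\<close>

lemma strict_mono_if_deriv_null:
  fixes g :: "real \<Rightarrow> real"
  assumes diff: "\<And>s. g differentiable (at s)"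
    and nonneg: "\<And>s. 0 \<le> deriv g s"
    and null: "{s. deriv g s = 0} \<in> null_sets lebesgue"
  shows "strict_mono g"
proof (rule strict_monoI)
  fix p q :: real assume "p < q"
  have D: "(g has_real_derivative deriv g s) (at s)" for s
    using diff by (simp add: DERIV_deriv_iff_real_differentiable)
  have mono: "g s \<le> g r" if "s \<le> r" for s r
    by (rule DERIV_nonneg_imp_nondecreasing[OF that]) (use D nonneg in blast)
  show "g p < g q"
  proof (rule ccontr)
    assume "\<not> g p < g q"
    then have const: "g s = g p" if "s \<in> {p..q}" for s
      using mono[of p s] mono[of s q] that by simp
    have "deriv g s = 0" if "s \<in> {p<..<q}" for s
    proof -
      have "g p = g r" if "r \<in> {p<..<q}" for r
        by (rule const[symmetric]) (use that in auto)
      then have "(g has_real_derivative 0) (at s)"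
        using that
        by (auto intro: has_field_derivative_transform_within_open[OF DERIV_const[of "g p"], where S = "{p<..<q}"])
      then show ?thesis by (rule DERIV_imp_deriv)
    qed
    then have "{p<..<q} \<subseteq> {s. deriv g s = 0}" by blast
    moreover have "negligible {s. deriv g s = 0}"
      using null by (simp add: negligible_iff_null_sets)
    ultimately have "negligible {p<..<q}" by (metis negligible_subset)
    then show False
      using open_not_negligible[of "{p<..<q}"] \<open>p < q\<close> by simp
  qed
qed

text \<open>Supplies the function \<open>\<Phi>\<close> of the cost. Open intervals are used because
  the interval integral in \<open>E\<close> unfolds to them.\<close>

lemma AE_bounded_primitive:
  fixes \<phi> :: "real \<Rightarrow> real"
  assumes meas: "\<phi> \<in> borel_measurable lebesgue"
    and bdd: "AE y in lebesgue. \<bar>\<phi> y\<bar> \<le> C"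
  obtains \<Phi> :: "real \<Rightarrow> real"
    where "\<And>p q. \<phi> absolutely_integrable_on {p<..<q}"
      and "\<And>p q. p \<le> q \<Longrightarrow> integral {p<..<q} \<phi> = \<Phi> q - \<Phi> p"
      and "\<And>p q. \<bar>\<Phi> p - \<Phi> q\<bar> \<le> C * \<bar>p - q\<bar>"
proof -
  \<comment> \<open>Truncation at height \<open>C\<close> changes \<open>\<phi>\<close> only on a
    null set and gives a function that is bounded everywhere.\<close>
  define \<psi> where "\<psi> y = max (- C) (min C (\<phi> y))" for y
  have C0: "0 \<le> C"
  proof -
    \<comment> \<open>Otherwise the bound fails everywhere and the whole line would be a null
      set.\<close>
    have "\<exists>y. \<bar>\<phi> y\<bar> \<le> C"
    proof (rule ccontr)
      assume "\<not> ?thesis"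
      then have "AE y in (lebesgue :: real measure). False"
        using bdd by simp
      then have "emeasure lebesgue (UNIV :: real set) = 0"
        by (simp add: AE_iff_null null_sets_def)
      then show False by simp
    qed
    then show ?thesis by linarith
  qed
  have \<psi>_meas: "\<psi> \<in> borel_measurable lebesgue"
    unfolding \<psi>_def using meas by measurable
  have \<psi>_bdd: "\<bar>\<psi> y\<bar> \<le> C" for y
    unfolding \<psi>_def using C0 by linarith
  obtain N where N: "N \<in> null_sets lebesgue" "{y. \<not> \<bar>\<phi> y\<bar> \<le> C} \<subseteq> N"
    using bdd unfolding eventually_ae_filter by auto
  have neg: "negligible N" using N(1) negligible_iff_null_sets by blast
  have eq: "\<phi> y = \<psi> y" if "y \<notin> N" for y
    using N(2) that unfolding \<psi>_def by force
  have \<psi>_int: "\<psi> absolutely_integrable_on {p..q}" for p q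
  proof -
    have "(\<lambda>_. C) integrable_on {p..q}"
      by (intro integrable_continuous_real continuous_intros)
    moreover have "\<psi> \<in> borel_measurable (lebesgue_on {p..q})"
      using \<psi>_meas by (rule measurable_restrict_space1)
    ultimately show ?thesis
      using \<psi>_bdd by (intro measurable_bounded_by_integrable_imp_absolutely_integrable[where g = "\<lambda>_. C"])
        auto
  qed
  have \<phi>_Icc: "\<phi> absolutely_integrable_on {p..q}" for p q
    by (rule absolutely_integrable_spike[OF \<psi>_int neg]) (use eq in auto)
  have int_eq: "integral {p..q} \<phi> = integral {p..q} \<psi>" for p q
    by (rule integral_spike[OF neg]) (use eq in auto)
  define \<Phi> where "\<Phi> y = (if 0 \<le> y then integral {0..y} \<phi> else - integral {y..0} \<phi>)" for y
  have int: "\<phi> integrable_on {p..q}" for p q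
    by (rule set_lebesgue_integral_eq_integral(1)[OF \<phi>_Icc])
  have diff: "integral {p..q} \<phi> = \<Phi> q - \<Phi> p" if "p \<le> q" for p q
  proof -
    consider "0 \<le> p" | "p < 0" "0 \<le> q" | "q < 0" by linarith
    then show ?thesis
    proof cases
      case 1
      then show ?thesis
        using Henstock_Kurzweil_Integration.integral_combine[of 0 p q \<phi>] int that by (simp add: \<Phi>_def)
    next
      case 2
      then show ?thesis
        using Henstock_Kurzweil_Integration.integral_combine[of p 0 q \<phi>] int by (simp add: \<Phi>_def)
    next
      case 3
      then show ?thesis
        using Henstock_Kurzweil_Integration.integral_combine[of p q 0 \<phi>] int that by (simp add: \<Phi>_def)
    qed
  qed
  have lip: "\<bar>\<Phi> q - \<Phi> p\<bar> \<le> C * (q - p)" if "p \<le> q" for p q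
  proof -
    have "norm (integral {p..q} \<psi>) \<le> integral {p..q} (\<lambda>_. C)"
      using \<psi>_bdd set_lebesgue_integral_eq_integral(1)[OF \<psi>_int]
      by (intro integral_norm_bound_integral) auto
    then show ?thesis using diff[OF that] int_eq that by (simp add: mult.commute)
  qed
  show ?thesis
  proof (rule that)
    show "\<phi> absolutely_integrable_on {p<..<q}" for p q
      by (rule set_integrable_subset[OF \<phi>_Icc[of p q]]) auto
    show "integral {p<..<q} \<phi> = \<Phi> q - \<Phi> p" if "p \<le> q" for p q
      using diff[OF that] by (simp add: integral_open_interval_real)
    show "\<bar>\<Phi> p - \<Phi> q\<bar> \<le> C * \<bar>p - q\<bar>" for p q
      using lip[of p q] lip[of q p] by (cases "p \<le> q") (auto simp: abs_minus_commute)
  qed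
qed

text \<open>The substitution \<open>y = x - t * a s\<close> reverses orientation and turns the
  \<open>\<phi>\<close> part into an increment of \<open>\<Phi>\<close>; the other part is
  integrated with the primitive \<open>s * a s - f s\<close> of
  \<open>deriv a s * s\<close>.\<close>

lemma integral_along_characteristics:
  fixes \<phi> \<Phi> a :: "real \<Rightarrow> real"
  assumes a_diff: "\<And>s. a differentiable (at s)"
    and a'_cont: "continuous_on UNIV (deriv a)"
    and a'_nonneg: "\<And>s. 0 \<le> deriv a s"
    and a_mono: "strict_mono a"
    and \<phi>_int: "\<And>p q. \<phi> absolutely_integrable_on {p<..<q}"
    and \<Phi>: "\<And>p q. p \<le> q \<Longrightarrow> integral {p<..<q} \<phi> = \<Phi> q - \<Phi> p"
    and f: "\<And>s. (f has_real_derivative a s) (at s)"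
    and "0 < t" "p \<le> q"
  shows "t * (LINT s:{p<..<q}|lebesgue. (deriv a s * (\<phi> (x - t * a s) - s)))
    = (\<Phi> (x - t * a p) + t * (p * a p - f p)) - (\<Phi> (x - t * a q) + t * (q * a q - f q))"
proof -
  have D: "(a has_real_derivative deriv a s) (at s)" for s
    using a_diff by (simp add: DERIV_deriv_iff_real_differentiable)
  have a_cont: "continuous_on A a" for A
    by (meson D DERIV_isCont continuous_at_imp_continuous_on)
  let ?g = "\<lambda>s. x - t * a s"
  have img: "?g ` {p<..<q} = {?g q<..<?g p}"
  proof (intro equalityI subsetI)
    fix y assume "y \<in> {?g q<..<?g p}"
    then have "a p \<le> (x - y) / t" "(x - y) / t \<le> a q"
      using \<open>0 < t\<close> by (auto simp: field_simps)
    then obtain s where s: "p \<le> s" "s \<le> q" "a s = (x - y) / t"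
      using IVT'[of a p "(x - y) / t" q] a_cont \<open>p \<le> q\<close> by blast
    then have y: "y = ?g s" using \<open>0 < t\<close> by (simp add: field_simps)
    with \<open>y \<in> _\<close> have "s \<noteq> p" "s \<noteq> q" by auto
    with s y show "y \<in> ?g ` {p<..<q}" by auto
  qed (use \<open>0 < t\<close> a_mono in \<open>auto simp: strict_mono_less\<close>)
  have inj: "inj_on ?g {p<..<q}"
    using \<open>0 < t\<close> a_mono by (auto simp: inj_on_def strict_mono_eq)
  have Dg: "(?g has_field_derivative (- t * deriv a s)) (at s within {p<..<q})" for s
    by (rule DERIV_subset[of _ _ _ UNIV]) (auto intro!: derivative_eq_intros D)
  have le: "?g q \<le> ?g p"
    using \<open>0 < t\<close> \<open>p \<le> q\<close> a_mono by (simp add: strict_mono_less_eq)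
  \<comment> \<open>The change of variables delivers integrability together with the value;
    integrability is what allows the integral to be split below.\<close>
  have *: "(\<lambda>s. \<bar>- t * deriv a s\<bar> * \<phi> (?g s)) absolutely_integrable_on {p<..<q} \<and>
    integral {p<..<q} (\<lambda>s. \<bar>- t * deriv a s\<bar> * \<phi> (?g s)) = \<Phi> (?g p) - \<Phi> (?g q)"
    using has_absolute_integral_change_of_variables_1'[OF _ Dg inj, of "\<phi>" "\<Phi> (?g p) - \<Phi> (?g q)"]
      \<phi>_int \<Phi>[OF le] img by simp
  have abs: "\<bar>- t * deriv a s\<bar> = t * deriv a s" for s
    using \<open>0 < t\<close> a'_nonneg[of s] by (simp add: abs_mult)
  have 1: "(\<lambda>s. t * (deriv a s * \<phi> (?g s))) absolutely_integrable_on {p<..<q}"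
    "integral {p<..<q} (\<lambda>s. t * (deriv a s * \<phi> (?g s))) = \<Phi> (?g p) - \<Phi> (?g q)"
    using * unfolding abs by (simp_all add: mult.assoc)
  have c: "continuous_on {p..q} (\<lambda>s. t * (deriv a s * s))"
    by (intro continuous_intros continuous_on_subset[OF a'_cont]) auto
  have 2: "(\<lambda>s. t * (deriv a s * s)) absolutely_integrable_on {p<..<q}"
    by (rule set_integrable_subset[OF absolutely_integrable_continuous_real[OF c]]) auto
  have "((\<lambda>s. t * (deriv a s * s)) has_integral t * (q * a q - f q) - t * (p * a p - f p)) {p..q}"
    by (rule fundamental_theorem_of_calculus[OF \<open>p \<le> q\<close>], unfold has_real_derivative_iff_has_vector_derivative[symmetric],
      rule DERIV_subset[of _ _ _ UNIV]) (auto intro!: derivative_eq_intros D f simp: algebra_simps)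
  then have 3: "integral {p<..<q} (\<lambda>s. t * (deriv a s * s)) = t * (q * a q - f q) - t * (p * a p - f p)"
    unfolding integral_open_interval_real[symmetric] by (rule integral_unique)
  have "t * (LINT s:{p<..<q}|lebesgue. (deriv a s * (\<phi> (?g s) - s)))
    = (LINT s:{p<..<q}|lebesgue. (t * (deriv a s * \<phi> (?g s)) - t * (deriv a s * s)))"
    unfolding set_integral_mult_right[symmetric] by (simp add: algebra_simps)
  also have "\<dots> = (LINT s:{p<..<q}|lebesgue. t * (deriv a s * \<phi> (?g s))) - (LINT s:{p<..<q}|lebesgue. t * (deriv a s * s))"
    using 1(1) 2 by (rule set_integral_diff)
  also have "\<dots> = (\<Phi> (?g p) - \<Phi> (?g q)) - (t * (q * a q - f q) - t * (p * a p - f p))"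
    using 1 2 3 by (simp only: set_lebesgue_integral_eq_integral)
  finally show ?thesis by simp
qed

text \<open>With 0 as one end point, that end contributes a term independent of \<open>u\<close>, so
  maximizing \<open>E\<close> means minimizing the subtracted cost. For negative \<open>u\<close>
  the sign of the interval integral restores the same formula.\<close>

lemma E_eq_cost_difference:
  fixes f \<phi> \<Phi> :: "real \<Rightarrow> real"
  assumes f_diff: "\<And>s. f differentiable (at s)"
    and f'_diff: "\<And>s. deriv f differentiable (at s)"
    and f''_cont: "continuous_on UNIV (deriv (deriv f))"
    and f''_nonneg: "\<And>s. 0 \<le> deriv (deriv f) s"
    and f'_mono: "strict_mono (deriv f)"
    and \<phi>_int: "\<And>p q. \<phi> absolutely_integrable_on {p<..<q}"
    and \<Phi>: "\<And>p q. p \<le> q \<Longrightarrow> integral {p<..<q} \<phi> = \<Phi> q - \<Phi> p"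
    and "0 < t"
  shows "E f \<phi> u x t =
    (\<Phi> (x - t * deriv f 0) - t * f 0) - (\<Phi> (x - t * deriv f u) + t * (u * deriv f u - f u))"
proof -
  have D: "(f has_real_derivative deriv f s) (at s)" for s
    using f_diff by (simp add: DERIV_deriv_iff_real_differentiable)
  note * = integral_along_characteristics[OF f'_diff f''_cont f''_nonneg f'_mono \<phi>_int \<Phi> D \<open>0 < t\<close>, of _ _ x]
  show ?thesis
  proof (cases "0 \<le> u")
    case True
    then show ?thesis
      using *[of 0 u] by (simp add: E_def interval_lebesgue_integral_def zero_ereal_def)
  next
    case False
    then show ?thesis
      using *[of u 0] by (simp add: E_def interval_lebesgue_integral_def zero_ereal_def)
  qed
qed

subsection \<open>Minimizers and backward characteristics\<close>

text \<open>A rational chosen in each interval determines its index.\<close>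

lemma countable_disjoint_intervals:
  fixes l r :: "'i \<Rightarrow> real"
  assumes "\<And>i. i \<in> D \<Longrightarrow> l i < r i"
    and disj: "\<And>i j. i \<in> D \<Longrightarrow> j \<in> D \<Longrightarrow> i \<noteq> j \<Longrightarrow> {l i<..<r i} \<inter> {l j<..<r j} = {}"
  shows "countable D"
proof -
  have "\<forall>i\<in>D. \<exists>q\<in>\<rat>. l i < q \<and> q < r i"
    using assms(1) Rats_dense_in_real by blast
  then obtain q where q: "\<And>i. i \<in> D \<Longrightarrow> q i \<in> \<rat> \<and> l i < q i \<and> q i < r i"
    by metis
  have "inj_on q D"
  proof (rule inj_onI, rule ccontr)
    fix i j assume "i \<in> D" "j \<in> D" "q i = q j" "i \<noteq> j"
    then have "q i \<in> {l i<..<r i} \<inter> {l j<..<r j}" using q by fastforce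
    then show False using disj \<open>i \<in> D\<close> \<open>j \<in> D\<close> \<open>i \<noteq> j\<close> by blast
  qed
  moreover have "countable (q ` D)"
    by (rule countable_subset[OF _ countable_rat]) (use q in auto)
  ultimately show ?thesis by (rule countable_image_inj_on[rotated])
qed

text \<open>Through \<open>maximizers_eq\<close> the functional \<open>E\<close> enters only by its
  minimization form; neither the integral nor the second derivative of \<open>f\<close> occurs in
  what follows.\<close>

locale lax_oleinik =
  fixes f \<phi> \<Phi> :: "real \<Rightarrow> real" and C :: real
  assumes f_deriv: "\<And>s. (f has_real_derivative deriv f s) (at s)"
    and speed_cont: "continuous_on UNIV (deriv f)"
    and speed_mono: "strict_mono (deriv f)"
    and \<Phi>_lipschitz: "\<And>p q. \<bar>\<Phi> p - \<Phi> q\<bar> \<le> C * \<bar>p - q\<bar>"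
    and maximizers_eq: "\<And>x t. 0 < t \<Longrightarrow> maximizers f \<phi> x t =
      {u. \<forall>v. \<Phi> (x - t * deriv f u) + t * (u * deriv f u - f u)
            \<le> \<Phi> (x - t * deriv f v) + t * (v * deriv f v - f v)}"
begin

abbreviation a :: "real \<Rightarrow> real" where "a \<equiv> deriv f"
abbreviation Mx :: "real \<Rightarrow> real \<Rightarrow> real set" where "Mx \<equiv> maximizers f \<phi>"
abbreviation uL :: "real \<Rightarrow> real \<Rightarrow> real" where "uL \<equiv> trace_left f \<phi>"
abbreviation uR :: "real \<Rightarrow> real \<Rightarrow> real" where "uR \<equiv> trace_right f \<phi>"

text \<open>The Legendre transform of \<open>f\<close>, parametrised by the point \<open>u\<close> of tangency.\<close>

definition leg :: "real \<Rightarrow> real" where "leg u = u * a u - f u"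

definition cost :: "real \<Rightarrow> real \<Rightarrow> real \<Rightarrow> real" where
  "cost u x t = \<Phi> (x - t * a u) + t * leg u"

text \<open>The line of \<open>char_line\<close> as a function of time, defined for all times so
  that its end point \<open>\<tau> = t\<close> may be used too.\<close>

definition chr :: "real \<Rightarrow> real \<Rightarrow> real \<Rightarrow> real \<Rightarrow> real" where
  "chr v x t \<tau> = x - (t - \<tau>) * a v"

lemma a_less [simp]: "a u < a v \<longleftrightarrow> u < v"
  using speed_mono by (rule strict_mono_less)

lemma a_le [simp]: "a u \<le> a v \<longleftrightarrow> u \<le> v"
  using speed_mono by (rule strict_mono_less_eq)

lemma a_eq [simp]: "a u = a v \<longleftrightarrow> u = v"
  using speed_mono by (rule strict_mono_eq)

lemma a_cont: "continuous_on A a"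
  using speed_cont continuous_on_subset by blast

lemma f_cont: "continuous_on A f"
  by (meson f_deriv DERIV_isCont continuous_at_imp_continuous_on)

lemma a_IVT:
  assumes "a p \<le> y" "y \<le> a q"
  obtains s where "p \<le> s" "s \<le> q" "a s = y"
proof -
  have "p \<le> q" using assms order_trans a_le by blast
  then show thesis using IVT'[of a p y q] assms a_cont that by blast
qed

lemma a_IVT_strict:
  assumes "a p < y" "y < a q"
  obtains s where "p < s" "s < q" "a s = y"
proof -
  obtain s where s: "p \<le> s" "s \<le> q" "a s = y"
    using a_IVT[of p y q] assms by auto
  then have "s \<noteq> p" "s \<noteq> q" using assms by auto
  with s that show thesis by force
qed

section \<open>Strict convexity and the Legendre transform\<close>

lemma tangent_less:
  assumes "k \<noteq> w"
  shows "f w + a w * (k - w) < f k"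
proof (cases "w < k")
  case True
  obtain z where "w < z" "z < k" "f k - f w = (k - w) * a z"
    using MVT2[OF True, of f a] f_deriv by blast
  moreover have "(k - w) * a w < (k - w) * a z"
    using \<open>w < z\<close> True by simp
  ultimately show ?thesis by (simp add: algebra_simps)
next
  case False
  then have "k < w" using assms by simp
  obtain z where "k < z" "z < w" "f w - f k = (w - k) * a z"
    using MVT2[OF \<open>k < w\<close>, of f a] f_deriv by blast
  moreover have "(w - k) * a z < (w - k) * a w"
    using \<open>z < w\<close> \<open>k < w\<close> by simp
  ultimately show ?thesis by (simp add: algebra_simps)
qed

text \<open>The Fenchel-Young inequality at slope \<open>a w\<close>; it is strict because
  \<open>f\<close> touches its tangent at \<open>w\<close> only there.\<close>

lemma leg_greater: "k \<noteq> w \<Longrightarrow> k * a w - f k < leg w"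
  using tangent_less[of k w] by (simp add: leg_def algebra_simps)

lemma leg_ge: "k * a w - f k \<le> leg w"
  using leg_greater[of k w] by (cases "k = w") (auto simp: leg_def)

lemma \<Phi>_cont: "continuous_on A \<Phi>"
proof (rule continuous_on_subset[OF lipschitz_on_continuous_on])
  show "(max C 0)-lipschitz_on UNIV \<Phi>"
  proof (rule lipschitz_onI)
    fix p q show "dist (\<Phi> p) (\<Phi> q) \<le> max C 0 * dist p q"
      using \<Phi>_lipschitz[of p q] mult_right_mono[of C "max C 0" "\<bar>p - q\<bar>"]
      by (simp add: dist_real_def)
  qed simp
qed simp

lemma C_nonneg: "0 \<le> C"
  using \<Phi>_lipschitz[of 0 1] by simp

section \<open>Existence, compactness and stability of minimizers\<close>

lemma Mx_iff: "0 < t \<Longrightarrow> u \<in> Mx x t \<longleftrightarrow> (\<forall>v. cost u x t \<le> cost v x t)"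
  by (simp add: maximizers_eq cost_def leg_def)

text \<open>Replacing \<open>u > C\<close> by \<open>C\<close> raises the \<open>\<Phi>\<close> term
  by at most \<open>C * t * (a u - a C)\<close>, while strict convexity lowers the Legendre term by
  more than that. The case \<open>u < - C\<close> is symmetric.\<close>

lemma cost_outside:
  assumes "0 < t"
  shows "C < u \<Longrightarrow> cost C x t < cost u x t"
    and "u < - C \<Longrightarrow> cost (- C) x t < cost u x t"
proof -
  assume "C < u"
  have "\<bar>\<Phi> (x - t * a u) - \<Phi> (x - t * a C)\<bar> \<le> C * (t * (a u - a C))"
    using \<Phi>_lipschitz[of "x - t * a u" "x - t * a C"] \<open>C < u\<close> \<open>0 < t\<close>
    by (simp add: right_diff_distrib[symmetric] abs_mult)
  moreover have "t * (C * a u - f C) < t * leg u"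
    using leg_greater[of C u] \<open>C < u\<close> \<open>0 < t\<close> by simp
  ultimately show "cost C x t < cost u x t"
    by (simp add: cost_def leg_def algebra_simps)
next
  assume "u < - C"
  have "\<bar>\<Phi> (x - t * a u) - \<Phi> (x - t * a (- C))\<bar> \<le> C * (t * (a (- C) - a u))"
    using \<Phi>_lipschitz[of "x - t * a u" "x - t * a (- C)"] \<open>u < - C\<close> \<open>0 < t\<close>
    by (simp add: right_diff_distrib[symmetric] abs_mult)
  moreover have "t * (- C * a u - f (- C)) < t * leg u"
    using leg_greater[of "- C" u] \<open>u < - C\<close> \<open>0 < t\<close> by simp
  ultimately show "cost (- C) x t < cost u x t"
    by (simp add: cost_def leg_def algebra_simps)
qed

lemma Mx_bounded:
  assumes "0 < t" "u \<in> Mx x t"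
  shows "- C \<le> u" "u \<le> C"
  using assms cost_outside[OF assms(1)] by (force simp: Mx_iff not_le[symmetric])+

lemma cost_cont [continuous_intros]:
  assumes "continuous_on A g" "continuous_on A h" "continuous_on A k"
  shows "continuous_on A (\<lambda>p. cost (g p) (h p) (k p))"
  unfolding cost_def leg_def
  by (intro continuous_intros assms continuous_on_compose2[OF \<Phi>_cont[of UNIV]]
      continuous_on_compose2[OF a_cont[of UNIV]] continuous_on_compose2[OF f_cont[of UNIV]]) auto

text \<open>A minimizer over the compact interval from \<open>- C\<close> to \<open>C\<close> is
  global by \<open>cost_outside\<close>.\<close>

lemma Mx_nonempty:
  assumes "0 < t"
  shows "Mx x t \<noteq> {}"
proof -
  have "continuous_on {- C..C} (\<lambda>u. cost u x t)"
    by (intro continuous_intros)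
  then obtain u where u: "u \<in> {- C..C}" "\<And>v. v \<in> {- C..C} \<Longrightarrow> cost u x t \<le> cost v x t"
    using continuous_attains_inf[of "{- C..C}" "\<lambda>u. cost u x t"] C_nonneg by auto
  have "cost u x t \<le> cost v x t" for v
  proof -
    have "cost u x t \<le> cost C x t" "cost u x t \<le> cost (- C) x t"
      using u(2) C_nonneg by auto
    then show ?thesis
      using cost_outside[OF assms, of v x] u(2)[of v] by (cases "v > C"; cases "v < - C") auto
  qed
  then have "u \<in> Mx x t" using assms by (simp add: Mx_iff)
  then show ?thesis by blast
qed

text \<open>Without a sign condition on \<open>t\<close> this set is closed in the whole space; it
  describes \<open>Mx\<close> at positive times.\<close>

definition graph :: "(real \<times> real \<times> real) set" where
  "graph = {(u, x, t). \<forall>v. cost u x t \<le> cost v x t}"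

lemma closed_graph: "closed graph"
proof -
  have "closed {p. cost (fst p) (fst (snd p)) (snd (snd p)) \<le> cost v (fst (snd p)) (snd (snd p))}" for v
    by (intro closed_Collect_le continuous_intros)
  then have "closed (\<Inter>v. {p. cost (fst p) (fst (snd p)) (snd (snd p)) \<le> cost v (fst (snd p)) (snd (snd p))})"
    by blast
  moreover have "graph = (\<Inter>v. {p. cost (fst p) (fst (snd p)) (snd (snd p)) \<le> cost v (fst (snd p)) (snd (snd p))})"
    by (auto simp: graph_def)
  ultimately show ?thesis by simp
qed

lemma in_graph: "0 < t \<Longrightarrow> (u, x, t) \<in> graph \<longleftrightarrow> u \<in> Mx x t"
  by (simp add: graph_def Mx_iff)

text \<open>The points with a minimizer in \<open>{- C..C} - U\<close> form the projection of a
  closed set along a compact factor, hence a closed set. At positive times every minimizer lies in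
  \<open>{- C..C}\<close>.\<close>

lemma Mx_upper_hemicontinuous:
  assumes "0 < t" "open U" "Mx x t \<subseteq> U"
  shows "\<forall>\<^sub>F p in nhds (x, t). Mx (fst p) (snd p) \<subseteq> U"
proof -
  let ?B = "{p. \<exists>u. u \<in> {- C..C} - U \<and> (u, p) \<in> graph}"
  have "closed ?B"
    using closed_graph \<open>open U\<close>
    by (intro closed_compact_projection compact_diff) auto
  moreover have "(x, t) \<notin> ?B" using assms by (auto simp: in_graph)
  ultimately have "\<forall>\<^sub>F p in nhds (x, t). p \<notin> ?B"
    using eventually_nhds_in_open[of "- ?B" "(x, t)"] by (simp add: open_closed)
  moreover have "\<forall>\<^sub>F p in nhds (x, t). 0 < snd p"
    using \<open>0 < t\<close> by (intro order_tendstoD[OF tendsto_snd[OF filterlim_ident]]) auto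
  ultimately show ?thesis
  proof eventually_elim
    case (elim p)
    obtain y s where "p = (y, s)" by force
    with elim show ?case using Mx_bounded[of s _ y] by (fastforce simp: in_graph)
  qed
qed

lemma compact_Mx:
  assumes "0 < t"
  shows "compact (Mx x t)"
proof -
  have "Mx x t = (\<lambda>u. (u, x, t)) -` graph" using in_graph[OF assms] by auto
  then have "closed (Mx x t)"
    using closed_graph by (simp add: closed_vimage continuous_intros)
  moreover have "bounded (Mx x t)"
    using Mx_bounded[OF assms] by (intro bounded_subset[OF bounded_closed_interval[of "- C" C]]) auto
  ultimately show ?thesis by (simp add: compact_eq_bounded_closed)
qed

lemma
  assumes "0 < t"
  shows uL_in: "uL x t \<in> Mx x t" and uR_in: "uR x t \<in> Mx x t"
    and uL_ge: "u \<in> Mx x t \<Longrightarrow> u \<le> uL x t" and uR_le: "u \<in> Mx x t \<Longrightarrow> uR x t \<le> u"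
proof -
  have b: "bounded (Mx x t)" "closed (Mx x t)"
    using compact_Mx[OF assms] compact_imp_bounded compact_imp_closed by blast+
  then show "uL x t \<in> Mx x t" "uR x t \<in> Mx x t"
    using Mx_nonempty[OF assms]
    by (auto simp: trace_left_def trace_right_def entropy_solution_def
        intro!: closed_contains_Sup closed_contains_Inf bounded_imp_bdd_above bounded_imp_bdd_below)
  show "u \<le> uL x t" "uR x t \<le> u" if "u \<in> Mx x t"
    using that b unfolding trace_left_def trace_right_def entropy_solution_def
    by (auto intro!: cSup_upper cInf_lower bounded_imp_bdd_above bounded_imp_bdd_below)
qed

lemma uR_le_uL: "0 < t \<Longrightarrow> uR x t \<le> uL x t"
  using uL_in uR_le by blast

lemma uL_uR_eq_imp:
  assumes "0 < t" "Mx x t = {v}"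
  shows "uL x t = v" "uR x t = v"
  using uL_in[OF assms(1), of x] uR_in[OF assms(1), of x] assms(2) by auto

text \<open>By strict convexity (dynamic programming), only \<open>v\<close> is minimal on the open
  backward characteristic of a minimizer \<open>v\<close>.\<close>

lemma Mx_on_chr:
  assumes "v \<in> Mx x t" "0 < \<tau>" "\<tau> < t"
  shows "Mx (chr v x t \<tau>) \<tau> = {v}"
proof -
  let ?\<xi> = "chr v x t \<tau>"
  have t: "0 < t" using assms by simp
  have less: "cost v ?\<xi> \<tau> < cost w ?\<xi> \<tau>" if "w \<noteq> v" for w
  proof -
    \<comment> \<open>Going back from \<open>(x, t)\<close> with speed \<open>a v\<close> to time
      \<open>\<tau>\<close> and then with speed \<open>a w\<close> has average speed
      \<open>?y\<close>. The straight line with this speed has the same foot and, by strict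
      convexity, a smaller Legendre cost than the broken one.\<close>
    let ?y = "(\<tau> * a w + (t - \<tau>) * a v) / t"
    have "a (min v w) \<le> ?y \<and> ?y \<le> a (max v w)"
    proof -
      have "\<tau> * a (min v w) + (t - \<tau>) * a (min v w) \<le> \<tau> * a w + (t - \<tau>) * a v"
        "\<tau> * a w + (t - \<tau>) * a v \<le> \<tau> * a (max v w) + (t - \<tau>) * a (max v w)"
        using assms by (intro add_mono mult_left_mono; simp)+
      then show ?thesis using t by (simp add: field_simps)
    qed
    then obtain m where m: "a m = ?y" using a_IVT by metis
    have tm: "t * a m = \<tau> * a w + (t - \<tau>) * a v" using m t by simp
    have "m \<noteq> w \<or> m \<noteq> v" using that by auto
    then have c1: "t * leg m < \<tau> * leg w + (t - \<tau>) * leg v"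
    proof -
      have "t * leg m = \<tau> * (m * a w - f m) + (t - \<tau>) * (m * a v - f m)"
        using arg_cong[OF tm, of "\<lambda>z. m * z"] by (simp add: leg_def algebra_simps)
      also have "\<dots> < \<tau> * leg w + (t - \<tau>) * leg v"
      proof (cases "m = w")
        case True
        then show ?thesis using that leg_greater[of m v] assms
          by (simp add: leg_def)
      next
        case False
        then have "\<tau> * (m * a w - f m) < \<tau> * leg w"
          using leg_greater[of m w] assms by simp
        moreover have "(t - \<tau>) * (m * a v - f m) \<le> (t - \<tau>) * leg v"
          using leg_ge[of m v] assms by simp
        ultimately show ?thesis by linarith
      qed
      finally show ?thesis .
    qed
    have e: "x - t * a m = ?\<xi> - \<tau> * a w" "x - t * a v = ?\<xi> - \<tau> * a v"
      using tm by (simp_all add: chr_def algebra_simps)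
    have "cost v x t \<le> cost m x t" using assms t by (simp add: Mx_iff)
    with c1 show ?thesis unfolding cost_def e by (simp add: left_diff_distrib)
  qed
  then have "v \<in> Mx ?\<xi> \<tau>"
    unfolding Mx_iff[OF \<open>0 < \<tau>\<close>] by (metis less_imp_le order_refl)
  moreover have "w \<notin> Mx ?\<xi> \<tau>" if "w \<noteq> v" for w
    using less[OF that] by (auto simp: Mx_iff[OF \<open>0 < \<tau>\<close>] not_le[symmetric])
  ultimately show ?thesis by blast
qed

section \<open>Order of backward characteristics\<close>

lemma chr_end [simp]: "chr v x t t = x"
  by (simp add: chr_def)

lemma chr_cont [continuous_intros]: "continuous_on A (chr v x t)"
  unfolding chr_def by (intro continuous_intros)

text \<open>A larger state is faster and therefore lies further to the left in the past. So
  \<open>uL\<close> gives the left edge of a triangle and \<open>uR\<close> the right edge.\<close>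

lemma chr_le: "\<tau> \<le> t \<Longrightarrow> v \<le> w \<Longrightarrow> chr w x t \<tau> \<le> chr v x t \<tau>"
  by (simp add: chr_def mult_left_mono)

lemma chr_less_iff: "\<tau> < t \<Longrightarrow> chr w x t \<tau> < chr v x t \<tau> \<longleftrightarrow> v < w"
  by (simp add: chr_def)

text \<open>One of the two lines is strictly before its end at \<open>\<tau>\<close>, so its state
  is the only minimizer at the common point; the other state is a minimizer there as well.\<close>

lemma chr_meet:
  assumes "v \<in> Mx x t" "w \<in> Mx y s" "0 < \<tau>" "\<tau> \<le> t" "\<tau> \<le> s" "\<tau> < t \<or> \<tau> < s"
    and "chr v x t \<tau> = chr w y s \<tau>"
  shows "v = w"
proof (cases "\<tau> < t")
  case True
  then have 1: "Mx (chr v x t \<tau>) \<tau> = {v}" using Mx_on_chr assms by blast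
  show ?thesis
  proof (cases "\<tau> < s")
    case True
    then have "Mx (chr w y s \<tau>) \<tau> = {w}" using Mx_on_chr assms by blast
    then show ?thesis using 1 assms(7) by simp
  next
    case False
    then have "\<tau> = s" using assms by simp
    then show ?thesis using 1 assms by simp
  qed
next
  case False
  then have "\<tau> = t" "\<tau> < s" using assms by auto
  then have "Mx (chr w y s \<tau>) \<tau> = {w}" using Mx_on_chr assms by blast
  then show ?thesis using assms(1,7) \<open>\<tau> = t\<close> by simp
qed

text \<open>A change of order would force the lines to meet before \<open>r\<close>; equal states
  then make them parallel, hence equal at \<open>r\<close>.\<close>

lemma chr_less:
  assumes v: "v \<in> Mx x t" and w: "w \<in> Mx y s" and r: "r \<le> t" "r \<le> s"
    and less: "chr v x t r < chr w y s r" and \<tau>: "0 < \<tau>" "\<tau> \<le> r"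
  shows "chr v x t \<tau> < chr w y s \<tau>"
proof (rule ccontr)
  assume "\<not> ?thesis"
  then obtain \<sigma> where \<sigma>: "\<tau> \<le> \<sigma>" "\<sigma> \<le> r" "chr w y s \<sigma> - chr v x t \<sigma> = 0"
    using IVT'[of "\<lambda>\<sigma>. chr w y s \<sigma> - chr v x t \<sigma>" \<tau> 0 r] less \<tau>
    by (auto intro!: continuous_intros)
  then have "\<sigma> < r" using less by (cases "\<sigma> = r") auto
  then have "v = w" using chr_meet[OF v w, of \<sigma>] \<sigma> r \<tau> by simp
  then show False using \<sigma> less by (simp add: chr_def algebra_simps)
qed

text \<open>If the lines touch at \<open>r\<close>, they coincide by \<open>chr_meet\<close>. This
  is the case in which a vertex lies on the edge of a later triangle.\<close>

lemma chr_weak: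
  assumes v: "v \<in> Mx x t" and w: "w \<in> Mx y s" and r: "r \<le> t" "r \<le> s" "r < t \<or> r < s"
    and le: "chr v x t r \<le> chr w y s r" and \<tau>: "0 < \<tau>" "\<tau> \<le> r"
  shows "chr v x t \<tau> \<le> chr w y s \<tau>"
proof (cases "chr v x t r = chr w y s r")
  case True
  then have "v = w" using chr_meet[OF v w, of r] r \<tau> by simp
  then show ?thesis using True by (simp add: chr_def algebra_simps)
next
  case False
  then show ?thesis using chr_less[OF v w r(1,2) _ \<tau>] le by simp
qed

text \<open>The point \<open>(z, t)\<close> lies in the closed backward triangle of \<open>(y, T)\<close>.\<close>

definition captured :: "real \<Rightarrow> real \<Rightarrow> real \<Rightarrow> real \<Rightarrow> bool" where
  "captured z t y T \<longleftrightarrow> chr (uL y T) y T t \<le> z \<and> z \<le> chr (uR y T) y T t"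

text \<open>Ordered vertices at time \<open>T\<close> keep their extremal characteristics ordered in
  the past. Hence triangles with distinct vertices at the same time are disjoint, which is the
  source of uniqueness.\<close>

lemma captured_order:
  assumes "y < y'" "0 < t" "t \<le> T"
  shows "chr (uR y T) y T t < chr (uL y' T) y' T t"
  using chr_less[of "uR y T" y T "uL y' T" y' T T t] assms uL_in uR_in by simp

lemma captured_unique:
  assumes "captured z t y T" "captured z t y' T" "0 < t" "t \<le> T"
  shows "y = y'"
  using captured_order[of y y' t T] captured_order[of y' y t T] assms
  by (fastforce simp: captured_def neq_iff)

lemma triangle_nested:
  assumes "captured z t y T" "0 < \<tau>" "\<tau> \<le> t" "t < T"
  shows "chr (uL y T) y T \<tau> \<le> chr (uL z t) z t \<tau>" "chr (uR z t) z t \<tau> \<le> chr (uR y T) y T \<tau>"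
  using assms chr_weak[of "uL y T" y T "uL z t" z t t \<tau>] chr_weak[of "uR z t" z t "uR y T" y T t \<tau>]
  by (auto simp: captured_def uL_in uR_in)

section \<open>Triangles as regions between characteristics, and gaps\<close>

lemma in_back_triangle:
  "(\<xi>, \<tau>) \<in> back_triangle f G y t \<longleftrightarrow> 0 < \<tau> \<and> \<tau> < t \<and> (\<exists>v\<in>G. \<xi> = chr v y t \<tau>)"
  by (auto simp: back_triangle_def char_line_def chr_def algebra_simps)

text \<open>The slope of the segment from a point between the edges to the vertex is the speed of
  some state, by the intermediate value theorem.\<close>

lemma in_back_triangle_Ioo:
  "(\<xi>, \<tau>) \<in> back_triangle f {c<..<d} y t \<longleftrightarrow>
    0 < \<tau> \<and> \<tau> < t \<and> chr d y t \<tau> < \<xi> \<and> \<xi> < chr c y t \<tau>"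
proof (cases "0 < \<tau> \<and> \<tau> < t")
  case True
  have "\<exists>v\<in>{c<..<d}. \<xi> = chr v y t \<tau>" if "chr d y t \<tau> < \<xi>" "\<xi> < chr c y t \<tau>"
  proof -
    have "a c < (y - \<xi>) / (t - \<tau>)" "(y - \<xi>) / (t - \<tau>) < a d"
      using that True by (auto simp: chr_def field_simps)
    then obtain v where "c < v" "v < d" "a v = (y - \<xi>) / (t - \<tau>)" by (rule a_IVT_strict)
    then show ?thesis using True by (intro bexI[of _ v]) (auto simp: chr_def)
  qed
  then show ?thesis using True by (auto simp: in_back_triangle chr_less_iff)
qed (auto simp: in_back_triangle)

lemma in_char_triangle:
  "(\<xi>, \<tau>) \<in> char_triangle f \<phi> y t \<longleftrightarrow> 0 < \<tau> \<and> \<tau> < t \<and> captured \<xi> \<tau> y t"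
proof (cases "0 < \<tau> \<and> \<tau> < t")
  case True
  have "\<exists>v\<in>{uR y t..uL y t}. \<xi> = chr v y t \<tau>" if "captured \<xi> \<tau> y t"
  proof -
    have "a (uR y t) \<le> (y - \<xi>) / (t - \<tau>)" "(y - \<xi>) / (t - \<tau>) \<le> a (uL y t)"
      using that True by (auto simp: captured_def chr_def field_simps)
    then obtain v where "uR y t \<le> v" "v \<le> uL y t" "a v = (y - \<xi>) / (t - \<tau>)" by (rule a_IVT)
    then show ?thesis using True by (intro bexI[of _ v]) (auto simp: chr_def)
  qed
  then show ?thesis
    using True by (auto simp: char_triangle_def in_back_triangle state_interval_def captured_def chr_le)
qed (auto simp: char_triangle_def in_back_triangle)

lemma char_triangle_mono:
  assumes "captured z t y T" "t < T"
  shows "char_triangle f \<phi> z t \<subseteq> char_triangle f \<phi> y T"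
proof
  fix p assume "p \<in> char_triangle f \<phi> z t"
  moreover obtain \<xi> \<tau> where "p = (\<xi>, \<tau>)" by force
  ultimately show "p \<in> char_triangle f \<phi> y T"
    using triangle_nested[OF assms(1), of \<tau>] assms(2)
    by (auto simp: in_char_triangle captured_def[of \<xi>])
qed

text \<open>The triangle does not contain its vertex, so \<open>z\<close> is reached as the limit
  along the left edge as time tends to \<open>t\<close>.\<close>

lemma captured_if_char_triangle_subset:
  assumes "char_triangle f \<phi> z t \<subseteq> char_triangle f \<phi> y T" "0 < t" "t \<le> T"
  shows "captured z t y T"
proof -
  have *: "captured (chr (uL z t) z t \<tau>) \<tau> y T" if "0 < \<tau>" "\<tau> < t" for \<tau>
  proof -
    have "captured (chr (uL z t) z t \<tau>) \<tau> z t"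
      using that assms uR_le_uL[of t z] by (simp add: captured_def chr_le)
    then show ?thesis using assms(1) that in_char_triangle by blast
  qed
  have ev: "\<forall>\<^sub>F \<tau> in at_left t. captured (chr (uL z t) z t \<tau>) \<tau> y T"
    using eventually_at_left_real[OF \<open>0 < t\<close>] by eventually_elim (use * in auto)
  have lim: "(chr v y' s \<longlongrightarrow> chr v y' s t) (at_left t)" for v y' s
    using chr_cont[of UNIV v y' s] unfolding continuous_on_def
    by (meson UNIV_I tendsto_within_subset top_greatest)
  have "chr (uL y T) y T t \<le> chr (uL z t) z t t"
    by (rule tendsto_le[OF _ lim lim]) (use ev in \<open>auto simp: captured_def elim: eventually_mono\<close>)
  moreover have "chr (uL z t) z t t \<le> chr (uR y T) y T t"
    by (rule tendsto_le[OF _ lim lim]) (use ev in \<open>auto simp: captured_def elim: eventually_mono\<close>)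
  ultimately show ?thesis by (simp add: captured_def)
qed

text \<open>A connected set that contains a point inside the interval and one outside must contain
  \<open>c\<close> or \<open>d\<close>, and both are minimizers.\<close>

lemma gap_component:
  assumes "0 < t" "c < d" "c \<in> Mx y t" "d \<in> Mx y t" "{c<..<d} \<inter> Mx y t = {}"
  shows "{c<..<d} \<in> components (gaps f \<phi> y t)"
  unfolding in_components_maximal
proof (intro conjI allI impI)
  show "{c<..<d} \<noteq> {}" using assms by simp
  show "{c<..<d} \<subseteq> gaps f \<phi> y t"
    using assms uL_ge[of t d y] uR_le[of t c y] by (fastforce simp: gaps_def state_interval_def)
  show "connected {c<..<d}" by simp
  fix D assume D: "D \<noteq> {} \<and> {c<..<d} \<subseteq> D \<and> D \<subseteq> gaps f \<phi> y t \<and> connected D"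
  then have cd: "c \<notin> D" "d \<notin> D" using assms by (auto simp: gaps_def)
  obtain m where m: "c < m" "m < d" using assms(2) dense by blast
  then have "m \<in> D" using D by auto
  have "v \<in> {c<..<d}" if "v \<in> D" for v
  proof (rule ccontr)
    assume "v \<notin> {c<..<d}"
    then have "c \<in> {v..m} \<or> d \<in> {m..v}" using m by auto
    then show False
      using connected_contains_Icc[of D v m] connected_contains_Icc[of D m v] D \<open>m \<in> D\<close> that cd by blast
  qed
  then show "D = {c<..<d}" using D by blast
qed

section \<open>The value function and the Rankine-Hugoniot slope\<close>

text \<open>The minimal cost when \<open>s\<close> is positive; \<open>uL\<close> is an arbitrary
  choice among the minimizers, by \<open>V_eq\<close>.\<close>

definition V :: "real \<Rightarrow> real \<Rightarrow> real" where "V y s = cost (uL y s) y s"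

lemma V_le: "0 < t \<Longrightarrow> V x t \<le> cost v x t"
  using uL_in[of t x] by (simp add: V_def Mx_iff)

lemma V_eq: "0 < t \<Longrightarrow> u \<in> Mx x t \<Longrightarrow> V x t = cost u x t"
  using uL_in[of t x] by (simp add: V_def Mx_iff order_antisym)

text \<open>The competitor \<open>w\<close> starts from the same point of the initial line as the optimal \<open>u\<close>.\<close>

lemma V_diff_le:
  assumes "0 < t" "0 < s" "u \<in> Mx x t" "s * a w = y - x + t * a u"
  shows "V y s - V x t \<le> w * (y - x) - f w * (s - t)"
proof -
  have "V y s \<le> \<Phi> (x - t * a u) + s * leg w"
    using V_le[OF \<open>0 < s\<close>, of y w] assms(4) by (simp add: cost_def algebra_simps)
  moreover have "V x t = \<Phi> (x - t * a u) + t * leg u"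
    using V_eq[OF assms(1,3)] by (simp add: cost_def)
  moreover have "s * leg w = w * (y - x + t * a u) - s * f w"
    using arg_cong[OF assms(4), of "\<lambda>z. w * z"] by (simp add: leg_def algebra_simps)
  moreover have "t * (w * a u - f w) \<le> t * leg u"
    using leg_ge[of w u] \<open>0 < t\<close> by simp
  ultimately show ?thesis by (simp add: algebra_simps)
qed

text \<open>\<open>V_diff_le\<close> is used in both directions, from the foot of \<open>u\<close>
  and from the foot of \<open>U i\<close>. Both competitors tend to \<open>u\<close>, so the two
  one-sided bounds agree to first order.\<close>

lemma V_expansion:
  fixes X T U :: "'i \<Rightarrow> real"
  assumes "0 < t" "u \<in> Mx x t" "0 < \<epsilon>"
    and X: "(X \<longlongrightarrow> x) F" and T: "(T \<longlongrightarrow> t) F" and U: "(U \<longlongrightarrow> u) F"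
    and mem: "\<forall>\<^sub>F i in F. U i \<in> Mx (X i) (T i)"
  shows "\<forall>\<^sub>F i in F. \<bar>V (X i) (T i) - V x t - (u * (X i - x) - f u * (T i - t))\<bar>
    \<le> \<epsilon> * (\<bar>X i - x\<bar> + \<bar>T i - t\<bar>)"
proof -
  have "isCont f u" using f_deriv DERIV_isCont by blast
  then obtain \<eta>0 where \<eta>0: "0 < \<eta>0" "\<And>w. \<bar>w - u\<bar> < \<eta>0 \<Longrightarrow> \<bar>f w - f u\<bar> < \<epsilon>"
    using \<open>0 < \<epsilon>\<close> unfolding continuous_at_eps_delta by (auto simp: dist_real_def)
  \<comment> \<open>The bound \<open>\<epsilon>\<close> controls the coefficient of the space
    increment, \<open>\<eta>0\<close> that of the time increment.\<close>
  define \<eta> where "\<eta> = min \<eta>0 \<epsilon>"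
  have \<eta>: "0 < \<eta>" using \<eta>0 \<open>0 < \<epsilon>\<close> by (simp add: \<eta>_def)
  have near: "\<bar>(w * p - f w * q) - (u * p - f u * q)\<bar> \<le> \<epsilon> * (\<bar>p\<bar> + \<bar>q\<bar>)"
    if "u - \<eta> < w" "w < u + \<eta>" for w p q
  proof -
    have "\<bar>w - u\<bar> < \<eta>0" "\<bar>w - u\<bar> \<le> \<epsilon>"
      using that by (auto simp: \<eta>_def)
    moreover from this have "\<bar>f w - f u\<bar> \<le> \<epsilon>" using \<eta>0(2)[of w] by simp
    ultimately have "\<bar>w - u\<bar> \<le> \<epsilon>" "\<bar>f w - f u\<bar> \<le> \<epsilon>" by simp_all
    then have "\<bar>w - u\<bar> * \<bar>p\<bar> + \<bar>f w - f u\<bar> * \<bar>q\<bar> \<le> \<epsilon> * \<bar>p\<bar> + \<epsilon> * \<bar>q\<bar>"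
      by (intro add_mono mult_right_mono) auto
    moreover have "(w * p - f w * q) - (u * p - f u * q) = (w - u) * p - (f w - f u) * q"
      by (simp add: algebra_simps)
    ultimately show ?thesis
      using abs_triangle_ineq4[of "(w - u) * p" "(f w - f u) * q"]
      by (simp add: abs_mult distrib_left)
  qed
  have aU: "((\<lambda>i. a (U i)) \<longlongrightarrow> a u) F"
    using continuous_on_tendsto_compose[OF speed_cont U] by simp
  \<comment> \<open>The speed of the line from the foot of \<open>u\<close> to the point
    \<open>(X i, T i)\<close>.\<close>
  have "((\<lambda>i. (X i - x + t * a u) / T i) \<longlongrightarrow> (x - x + t * a u) / t) F"
    by (intro tendsto_intros X T) (use \<open>0 < t\<close> in simp)
  then have A: "((\<lambda>i. (X i - x + t * a u) / T i) \<longlongrightarrow> a u) F" using \<open>0 < t\<close> by simp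
  \<comment> \<open>The speed of the line from the foot of \<open>U i\<close> to the point
    \<open>(x, t)\<close>.\<close>
  have "((\<lambda>i. (x - X i + T i * a (U i)) / t) \<longlongrightarrow> (x - x + t * a u) / t) F"
    by (intro tendsto_intros X T aU) (use \<open>0 < t\<close> in simp)
  then have B: "((\<lambda>i. (x - X i + T i * a (U i)) / t) \<longlongrightarrow> a u) F" using \<open>0 < t\<close> by simp
  have lu: "a (u - \<eta>) < a u" "a u < a (u + \<eta>)" using \<eta> by simp_all
  show ?thesis
    using mem order_tendstoD(1)[OF T \<open>0 < t\<close>] order_tendstoD(1)[OF A lu(1)] order_tendstoD(2)[OF A lu(2)]
      order_tendstoD(1)[OF B lu(1)] order_tendstoD(2)[OF B lu(2)]
  proof eventually_elim
    case (elim i)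
    obtain w where w: "u - \<eta> < w" "w < u + \<eta>" "a w = (X i - x + t * a u) / T i"
      using a_IVT_strict elim by blast
    obtain w' where w': "u - \<eta> < w'" "w' < u + \<eta>" "a w' = (x - X i + T i * a (U i)) / t"
      using a_IVT_strict elim by blast
    have "V (X i) (T i) - V x t \<le> w * (X i - x) - f w * (T i - t)"
      using V_diff_le[OF \<open>0 < t\<close> _ assms(2), of "T i" w "X i"] w(3) elim by simp
    moreover have "V x t - V (X i) (T i) \<le> w' * (x - X i) - f w' * (t - T i)"
      using V_diff_le[OF _ \<open>0 < t\<close>, of "T i" "U i" "X i" w' x] w'(3) elim \<open>0 < t\<close> by simp
    moreover have "w' * (x - X i) - f w' * (t - T i) = - (w' * (X i - x) - f w' * (T i - t))"
      by (simp add: algebra_simps)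
    ultimately show ?case
      using near[OF w(1,2), of "X i - x" "T i - t"] near[OF w'(1,2), of "X i - x" "T i - t"]
      by linarith
  qed
qed

text \<open>Subtracting the expansions for \<open>u1\<close> and \<open>u2\<close> eliminates the
  value function; the Lipschitz bound turns the error into one of smaller order than the time
  increment.\<close>

lemma Rankine_Hugoniot:
  fixes X T U1 U2 :: "'i \<Rightarrow> real"
  assumes "0 < t" "u1 \<in> Mx x t" "u2 \<in> Mx x t" "u2 < u1"
    and X: "(X \<longlongrightarrow> x) F" and T: "(T \<longlongrightarrow> t) F"
    and U1: "(U1 \<longlongrightarrow> u1) F" and U2: "(U2 \<longlongrightarrow> u2) F"
    and mem1: "\<forall>\<^sub>F i in F. U1 i \<in> Mx (X i) (T i)" and mem2: "\<forall>\<^sub>F i in F. U2 i \<in> Mx (X i) (T i)"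
    and ne: "\<forall>\<^sub>F i in F. T i \<noteq> t" and lip: "\<forall>\<^sub>F i in F. \<bar>X i - x\<bar> \<le> L * \<bar>T i - t\<bar>" and "0 \<le> L"
  shows "((\<lambda>i. (X i - x) / (T i - t)) \<longlongrightarrow> (f u1 - f u2) / (u1 - u2)) F"
proof (rule tendstoI)
  fix e :: real assume "0 < e"
  \<comment> \<open>With this choice the two errors together reach only half of the allowed
    \<open>e * (u1 - u2)\<close> per unit of time.\<close>
  define \<epsilon> where "\<epsilon> = e * (u1 - u2) / (4 * (L + 1))"
  have "0 < \<epsilon>" using \<open>0 < e\<close> assms by (simp add: \<epsilon>_def)
  have small: "2 * (\<epsilon> * (L + 1)) < e * (u1 - u2)"
  proof -
    have "\<epsilon> * (L + 1) = e * (u1 - u2) / 4"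
      using \<open>0 \<le> L\<close> by (simp add: \<epsilon>_def field_simps)
    moreover have "0 < e * (u1 - u2)" using \<open>0 < e\<close> assms(4) by simp
    ultimately show ?thesis by simp
  qed
  show "\<forall>\<^sub>F i in F. dist ((X i - x) / (T i - t)) ((f u1 - f u2) / (u1 - u2)) < e"
    using V_expansion[OF assms(1,2) \<open>0 < \<epsilon>\<close> X T U1 mem1] V_expansion[OF assms(1,3) \<open>0 < \<epsilon>\<close> X T U2 mem2]
      ne lip
  proof eventually_elim
    case (elim i)
    let ?p = "X i - x" and ?q = "T i - t"
    have "\<bar>(u1 - u2) * ?p - (f u1 - f u2) * ?q\<bar> \<le> 2 * (\<epsilon> * (\<bar>?p\<bar> + \<bar>?q\<bar>))"
      using elim(1,2) by (simp add: algebra_simps)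
    also have "\<dots> \<le> 2 * (\<epsilon> * ((L + 1) * \<bar>?q\<bar>))"
      using elim(4) \<open>0 < \<epsilon>\<close> by (simp add: algebra_simps)
    also have "\<dots> = 2 * (\<epsilon> * (L + 1)) * \<bar>?q\<bar>" by simp
    also have "\<dots> < e * (u1 - u2) * \<bar>?q\<bar>"
      using small elim(3) by (intro mult_strict_right_mono) auto
    finally have less: "\<bar>(u1 - u2) * ?p - (f u1 - f u2) * ?q\<bar> < e * (u1 - u2) * \<bar>?q\<bar>" .
    have "?p / ?q - (f u1 - f u2) / (u1 - u2) = ((u1 - u2) * ?p - (f u1 - f u2) * ?q) / ((u1 - u2) * ?q)"
      using elim(3) assms(4) by (simp add: field_simps)
    then have "dist (?p / ?q) ((f u1 - f u2) / (u1 - u2))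
      = \<bar>(u1 - u2) * ?p - (f u1 - f u2) * ?q\<bar> / ((u1 - u2) * \<bar>?q\<bar>)"
      using assms(4) by (simp add: dist_real_def abs_mult)
    also have "\<dots> < e"
      using less elim(3) assms(4) by (subst pos_divide_less_eq) (auto simp: mult.assoc)
    finally show ?case .
  qed
qed

end

subsection \<open>Curves of jumps\<close>

locale shock_curve = lax_oleinik +
  fixes x :: "real \<Rightarrow> real" and t0 :: real
  assumes t0_pos: "0 < t0"
    and x_cont: "continuous_on {t0..} x"
    and x_disc: "discontinuous_along f \<phi> t0 x"
begin

lemma jump: "t0 < t \<Longrightarrow> uR (x t) t < uL (x t) t"
  using x_disc by (simp add: discontinuous_along_def)

section \<open>The curve stays in the triangles of its later points\<close>

text \<open>On such a characteristic the minimizer is unique, so both traces agree and there is no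
  jump.\<close>

lemma off_chr:
  assumes "v \<in> Mx y T" "t0 < t" "t < T"
  shows "x t \<noteq> chr v y T t"
proof
  assume "x t = chr v y T t"
  then have "Mx (x t) t = {v}" using Mx_on_chr assms t0_pos by simp
  then show False using uL_uR_eq_imp[of t "x t" v] jump[of t] assms t0_pos by simp
qed

text \<open>The intermediate value theorem together with \<open>off_chr\<close>. The ends are
  assumed off the line since \<open>s\<close> may be \<open>t0\<close> and \<open>r\<close> may be
  \<open>T\<close>, which \<open>off_chr\<close> does not cover.\<close>

lemma no_crossing:
  assumes v: "v \<in> Mx y T" and "t0 \<le> s" "s \<le> r" "r \<le> T" and ends: "x s \<noteq> chr v y T s" "x r \<noteq> chr v y T r"
  shows "x s < chr v y T s \<longleftrightarrow> x r < chr v y T r"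
proof -
  let ?h = "\<lambda>t. x t - chr v y T t"
  have cont: "continuous_on {s..r} ?h"
    by (intro continuous_intros continuous_on_subset[OF x_cont]) (use assms in auto)
  have zero: "?h t \<noteq> 0" if "s \<le> t" "t \<le> r" for t
  proof (cases "t = s \<or> t = r")
    case False
    then show ?thesis using off_chr[OF v, of t] that assms by simp
  qed (use ends in auto)
  have "\<not> (?h s \<le> 0 \<and> 0 \<le> ?h r)" "\<not> (?h r \<le> 0 \<and> 0 \<le> ?h s)"
    using IVT'[of ?h s 0 r] IVT2'[of ?h r 0 s] cont zero \<open>s \<le> r\<close> by blast+
  then show ?thesis using ends by linarith
qed

lemma no_crossing_end:
  assumes "v \<in> Mx y T" "t0 < s" "s < T" "y \<noteq> x T"
  shows "x s < chr v y T s \<longleftrightarrow> x T < y"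
  using no_crossing[of v y T s T] off_chr[of v y T s] assms by simp

text \<open>If the curve left the triangle of \<open>(x T, T)\<close>, it would have to cross an extremal
  backward characteristic from some \<open>(y, T)\<close> with \<open>y\<close> near \<open>x T\<close>, at a point where the
  minimizer is unique.\<close>

lemma captured_open_past:
  assumes "t0 < t" "t < T"
  shows "captured (x t) t (x T) T"
proof (rule ccontr)
  assume "\<not> ?thesis"
  then consider "x t < chr (uL (x T) T) (x T) T t" | "chr (uR (x T) T) (x T) T t < x t"
    by (auto simp: captured_def)
  then show False
  proof cases
    case 1
    then have "a (uL (x T) T) < (x T - x t) / (T - t)" using assms by (simp add: chr_def field_simps)
    \<comment> \<open>For \<open>y\<close> slightly to the left of \<open>x T\<close> all minimizers
      have speed below \<open>K\<close>, so their characteristics pass to the right of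
      \<open>x t\<close>, although \<open>y < x T\<close>.\<close>
    then obtain K where K: "a (uL (x T) T) < K" "K < (x T - x t) / (T - t)" using dense by blast
    have "open {v. a v < K}" by (intro open_Collect_less a_cont continuous_intros)
    moreover have "a v < K" if "v \<in> Mx (x T) T" for v
    proof -
      have "a v \<le> a (uL (x T) T)" using uL_ge that assms t0_pos by simp
      then show ?thesis using K by linarith
    qed
    ultimately have "\<forall>\<^sub>F p in nhds (x T, T). Mx (fst p) (snd p) \<subseteq> {v. a v < K}"
      using assms t0_pos by (intro Mx_upper_hemicontinuous) auto
    moreover have "filterlim (\<lambda>y. (y, T)) (nhds (x T, T)) (at_left (x T))"
      by (intro tendsto_intros)
    ultimately have "\<forall>\<^sub>F y in at_left (x T). Mx y T \<subseteq> {v. a v < K}"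
      using eventually_compose_filterlim by fastforce
    moreover have "\<forall>\<^sub>F y in at_left (x T). x t + (T - t) * K < y"
      by (rule order_tendstoD[OF tendsto_ident_at]) (use K(2) assms in \<open>simp add: field_simps\<close>)
    moreover have "\<forall>\<^sub>F y in at_left (x T). y < x T"
      by (simp add: eventually_at_filter)
    ultimately have "\<forall>\<^sub>F y in at_left (x T). False"
    proof eventually_elim
      case (elim y)
      have in_y: "uL y T \<in> Mx y T" using uL_in assms t0_pos by simp
      then have "(T - t) * a (uL y T) < (T - t) * K" using elim assms by auto
      then have "x t < chr (uL y T) y T t" using elim by (simp add: chr_def)
      then show ?case using no_crossing_end[OF in_y, of t] assms elim by simp
    qed
    then show False by simp
  next
    case 2
    then have "(x T - x t) / (T - t) < a (uR (x T) T)" using assms by (simp add: chr_def field_simps)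
    then obtain K where K: "K < a (uR (x T) T)" "(x T - x t) / (T - t) < K" using dense by blast
    have "open {v. K < a v}" by (intro open_Collect_less a_cont continuous_intros)
    moreover have "K < a v" if "v \<in> Mx (x T) T" for v
    proof -
      have "a (uR (x T) T) \<le> a v" using uR_le that assms t0_pos by simp
      then show ?thesis using K by linarith
    qed
    ultimately have "\<forall>\<^sub>F p in nhds (x T, T). Mx (fst p) (snd p) \<subseteq> {v. K < a v}"
      using assms t0_pos by (intro Mx_upper_hemicontinuous) auto
    moreover have "filterlim (\<lambda>y. (y, T)) (nhds (x T, T)) (at_right (x T))"
      by (intro tendsto_intros)
    ultimately have "\<forall>\<^sub>F y in at_right (x T). Mx y T \<subseteq> {v. K < a v}"
      using eventually_compose_filterlim by fastforce
    moreover have "\<forall>\<^sub>F y in at_right (x T). y < x t + (T - t) * K"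
      by (rule order_tendstoD[OF tendsto_ident_at]) (use K(2) assms in \<open>simp add: field_simps\<close>)
    moreover have "\<forall>\<^sub>F y in at_right (x T). x T < y"
      by (simp add: eventually_at_filter)
    ultimately have "\<forall>\<^sub>F y in at_right (x T). False"
    proof eventually_elim
      case (elim y)
      have in_y: "uR y T \<in> Mx y T" using uR_in assms t0_pos by simp
      then have "(T - t) * K < (T - t) * a (uR y T)" using elim assms by auto
      then have "chr (uR y T) y T t < x t" using elim by (simp add: chr_def)
      then show ?case using no_crossing_end[OF in_y, of t] assms elim by simp
    qed
    then show False by simp
  qed
qed

text \<open>Since no jump is assumed at \<open>t0\<close>, the initial point is reached by
  continuity from later times.\<close>

lemma captured_past:
  assumes "t0 \<le> t" "t < T"
  shows "captured (x t) t (x T) T"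
proof (cases "t = t0")
  case True
  have ev: "\<forall>\<^sub>F s in at_right t0. captured (x s) s (x T) T"
    using eventually_at_right_real[of t0 T] assms True
    by (auto simp: captured_open_past elim!: eventually_mono)
  have x: "(x \<longlongrightarrow> x t0) (at_right t0)"
    by (rule tendsto_within_subset[where S = "{t0..}"]) (use x_cont in \<open>auto simp: continuous_on_def\<close>)
  have c: "(chr v y T \<longlongrightarrow> chr v y T t0) (at_right t0)" for v y
    using chr_cont[of UNIV v y T] unfolding continuous_on_def
    by (meson UNIV_I tendsto_within_subset top_greatest)
  have "chr (uL (x T) T) (x T) T t0 \<le> x t0"
    by (rule tendsto_le[OF _ x c]) (use ev in \<open>auto simp: captured_def elim: eventually_mono\<close>)
  moreover have "x t0 \<le> chr (uR (x T) T) (x T) T t0"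
    by (rule tendsto_le[OF _ c x]) (use ev in \<open>auto simp: captured_def elim: eventually_mono\<close>)
  ultimately show ?thesis using True by (simp add: captured_def)
next
  case False
  then show ?thesis using captured_open_past assms by simp
qed

lemma nested: "nested_char_triangles f \<phi> (x t0) t0 x"
  unfolding nested_char_triangles_def by (simp add: char_triangle_mono captured_past)

text \<open>A competing curve has triangles containing that of the initial point, so each of them
  captures this point; at each later time only one vertex can do so.\<close>

lemma forward_characteristic: "forward_generalized_characteristic f \<phi> (x t0) t0 x"
  unfolding forward_generalized_characteristic_def
proof (intro conjI allI impI)
  fix y t assume y: "nested_char_triangles f \<phi> (x t0) t0 y" and "t0 \<le> t"
  show "y t = x t"
  proof (cases "t = t0")
    case False
    then have "t0 < t" using \<open>t0 \<le> t\<close> by simp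
    \<comment> \<open>The nesting condition speaks of two later times; any time after
      \<open>t\<close> serves as the second.\<close>
    then have "char_triangle f \<phi> (x t0) t0 \<subseteq> char_triangle f \<phi> (y t) t"
      using y unfolding nested_char_triangles_def by (metis gt_ex)
    then have "captured (x t0) t0 (y t) t"
      using captured_if_char_triangle_subset t0_pos \<open>t0 \<le> t\<close> by blast
    then show ?thesis using captured_unique captured_past[of t0 t] t0_pos \<open>t0 < t\<close> by simp
  qed (use y in \<open>simp add: nested_char_triangles_def\<close>)
qed (rule nested)

section \<open>The gap selected by the past of the curve\<close>

text \<open>Stated by end points and edges, in the form the ordering lemmas use;
  \<open>past_gap_component\<close> and \<open>past_gap_contains_past\<close> translate it back to
  components and triangles.\<close>

definition past_gap :: "real \<Rightarrow> real \<Rightarrow> real \<Rightarrow> bool" where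
  "past_gap t c d \<longleftrightarrow> c < d \<and> c \<in> Mx (x t) t \<and> d \<in> Mx (x t) t \<and> {c<..<d} \<inter> Mx (x t) t = {} \<and>
    (\<forall>\<tau>\<in>{t0..<t}. chr d (x t) t \<tau> < x \<tau> \<and> x \<tau> < chr c (x t) t \<tau>)"

text \<open>The initial point needs a separate argument: it may carry a unique minimizer, so it is
  not kept off the characteristics by a jump.\<close>

lemma start_off_chr:
  assumes w: "w \<in> Mx (x t) t" and "t0 < t"
  shows "x t0 \<noteq> chr w (x t) t t0"
proof
  assume eq: "x t0 = chr w (x t) t t0"
  \<comment> \<open>At the intermediate time the curve is strictly on one side of the
    characteristic. Then so is the triangle of \<open>(x \<tau>, \<tau>)\<close> at time
    \<open>t0\<close>, although it captures the initial point.\<close>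
  define \<tau> where "\<tau> = (t0 + t) / 2"
  have \<tau>: "t0 < \<tau>" "\<tau> < t" using \<open>t0 < t\<close> by (auto simp: \<tau>_def)
  have cap: "captured (x t0) t0 (x \<tau>) \<tau>" using captured_past \<tau> by simp
  have "x \<tau> \<noteq> chr w (x t) t \<tau>" using off_chr w \<tau> by blast
  then consider "x \<tau> < chr w (x t) t \<tau>" | "chr w (x t) t \<tau> < x \<tau>" by linarith
  then show False
  proof cases
    case 1
    then have "chr (uR (x \<tau>) \<tau>) (x \<tau>) \<tau> t0 < chr w (x t) t t0"
      using chr_less[of "uR (x \<tau>) \<tau>" "x \<tau>" \<tau> w "x t" t \<tau> t0] w \<tau> t0_pos uR_in by simp
    then show False using cap eq by (simp add: captured_def)
  next
    case 2
    then have "chr w (x t) t t0 < chr (uL (x \<tau>) \<tau>) (x \<tau>) \<tau> t0"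
      using chr_less[of w "x t" t "uL (x \<tau>) \<tau>" "x \<tau>" \<tau> \<tau> t0] w \<tau> t0_pos uL_in by simp
    then show False using cap eq by (simp add: captured_def)
  qed
qed

text \<open>The state whose speed is the slope of the chord to the initial point is not a minimizer;
  \<open>c\<close> and \<open>d\<close> are the nearest minimizers on its two sides.\<close>

lemma past_gap_exists:
  assumes "t0 < t"
  obtains c d where "past_gap t c d"
proof -
  have t: "0 < t" using assms t0_pos by simp
  let ?M = "Mx (x t) t"
  have cap: "captured (x t0) t0 (x t) t" using captured_past assms by simp
  have "a (uR (x t) t) \<le> (x t - x t0) / (t - t0)" "(x t - x t0) / (t - t0) \<le> a (uL (x t) t)"
    using cap assms by (auto simp: captured_def chr_def field_simps)
  then obtain w where w: "uR (x t) t \<le> w" "w \<le> uL (x t) t" "a w = (x t - x t0) / (t - t0)"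
    by (rule a_IVT)
  then have xw: "x t0 = chr w (x t) t t0" using assms by (simp add: chr_def)
  have "w \<notin> ?M" using start_off_chr xw assms by blast
  have "compact (?M \<inter> {..w})" "?M \<inter> {..w} \<noteq> {}"
    using compact_Mx[OF t] uR_in[OF t] w by (auto intro: compact_Int_closed)
  then obtain c where c: "c \<in> ?M" "c \<le> w" "\<And>v. v \<in> ?M \<Longrightarrow> v \<le> w \<Longrightarrow> v \<le> c"
    using compact_attains_sup[of "?M \<inter> {..w}"] by auto
  have "compact (?M \<inter> {w..})" "?M \<inter> {w..} \<noteq> {}"
    using compact_Mx[OF t] uL_in[OF t] w by (auto intro: compact_Int_closed)
  then obtain d where d: "d \<in> ?M" "w \<le> d" "\<And>v. v \<in> ?M \<Longrightarrow> w \<le> v \<Longrightarrow> d \<le> v"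
    using compact_attains_inf[of "?M \<inter> {w..}"] by auto
  have "c \<noteq> w" "w \<noteq> d" using c d \<open>w \<notin> ?M\<close> by auto
  then have cd: "c < w" "w < d" using c d by auto
  have start: "chr d (x t) t t0 < x t0" "x t0 < chr c (x t) t t0"
    using xw cd assms by (simp_all add: chr_less_iff)
  have side: "x \<tau> \<noteq> chr v (x t) t \<tau> \<and> (x \<tau> < chr v (x t) t \<tau> \<longleftrightarrow> x t0 < chr v (x t) t t0)"
    if "v \<in> ?M" "\<tau> \<in> {t0..<t}" for v \<tau>
  proof (cases "\<tau> = t0")
    case False
    then have "x \<tau> \<noteq> chr v (x t) t \<tau>" using off_chr that by simp
    then show ?thesis using no_crossing[of v "x t" t t0 \<tau>] start_off_chr that assms by auto
  qed (use start_off_chr that assms in auto)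
  have "past_gap t c d"
    unfolding past_gap_def
  proof (intro conjI ballI)
    show "{c<..<d} \<inter> ?M = {}" using c(3) d(3) by force
    fix \<tau> assume "\<tau> \<in> {t0..<t}"
    then show "chr d (x t) t \<tau> < x \<tau>" "x \<tau> < chr c (x t) t \<tau>"
      using side[OF d(1), of \<tau>] side[OF c(1), of \<tau>] start by auto
  qed (use c d cd in auto)
  then show thesis by (rule that)
qed

text \<open>At time \<open>s\<close> the curve is strictly between the two edges of the gap
  triangle, and \<open>chr_less\<close> carries the strict order to earlier times.\<close>

lemma chr_in_past_gap:
  assumes gap: "past_gap t c d" and "t0 \<le> s" "s < t" "0 < \<tau>" "\<tau> \<le> s" "v \<in> Mx (x s) s"
  shows "chr d (x t) t \<tau> < chr v (x s) s \<tau>" "chr v (x s) s \<tau> < chr c (x t) t \<tau>"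
  using assms chr_less[of d "x t" t v "x s" s s \<tau>] chr_less[of v "x s" s c "x t" t s \<tau>]
  by (auto simp: past_gap_def)

text \<open>Even the full earlier triangle fits into the later gap triangle; the nesting of gap
  triangles is a consequence.\<close>

lemma char_triangle_subset_gap:
  assumes gap: "past_gap t c d" and "t0 \<le> s" "s < t"
  shows "char_triangle f \<phi> (x s) s \<subseteq> back_triangle f {c<..<d} (x t) t"
proof
  fix p assume "p \<in> char_triangle f \<phi> (x s) s"
  moreover obtain \<xi> \<tau> where p: "p = (\<xi>, \<tau>)" by force
  ultimately have \<tau>: "0 < \<tau>" "\<tau> < s" "captured \<xi> \<tau> (x s) s" by (auto simp: in_char_triangle)
  have "0 < s" using assms t0_pos by simp
  then show "p \<in> back_triangle f {c<..<d} (x t) t"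
    using chr_in_past_gap(1)[OF gap assms(2,3), of \<tau> "uL (x s) s"] uL_in[of s "x s"]
      chr_in_past_gap(2)[OF gap assms(2,3), of \<tau> "uR (x s) s"] uR_in[of s "x s"] \<tau> assms p
    by (auto simp: in_back_triangle_Ioo captured_def)
qed

lemma back_triangle_component_subset:
  assumes "K \<in> components (gaps f \<phi> y s)"
  shows "back_triangle f K y s \<subseteq> char_triangle f \<phi> y s"
  using in_components_subset[OF assms] by (auto simp: char_triangle_def gaps_def in_back_triangle back_triangle_def)

lemma past_gap_component:
  assumes "past_gap t c d" "t0 < t"
  shows "{c<..<d} \<in> components (gaps f \<phi> (x t) t)"
  using assms t0_pos gap_component[of t c d "x t"] by (simp add: past_gap_def)

lemma past_gap_contains_past:
  assumes "past_gap t c d" "t0 < t"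
  shows "contains_past f \<phi> t0 x t {c<..<d}"
  using assms t0_pos past_gap_component by (auto simp: contains_past_def in_back_triangle_Ioo past_gap_def)

text \<open>A point before time \<open>t\<close> determines the speed, hence the state, of the line
  joining it to the vertex.\<close>

lemma component_eq_if_triangles_meet:
  assumes "K \<in> components (gaps f \<phi> y t)" "K' \<in> components (gaps f \<phi> y t)"
    and "p \<in> back_triangle f K y t" "p \<in> back_triangle f K' y t"
  shows "K = K'"
proof -
  obtain \<xi> \<tau> where p: "p = (\<xi>, \<tau>)" by force
  then obtain v v' where "v \<in> K" "v' \<in> K'" "chr v y t \<tau> = chr v' y t \<tau>" "\<tau> < t"
    using assms(3,4) by (auto simp: in_back_triangle)
  then have "K \<inter> K' \<noteq> {}" by (auto simp: chr_def)
  then show ?thesis using components_nonoverlap[OF assms(1,2)] by blast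
qed

lemma contains_past_unique:
  assumes "contains_past f \<phi> t0 x t K" "contains_past f \<phi> t0 x t K'" "t0 < t"
  shows "K = K'"
  using assms component_eq_if_triangles_meet[of K "x t" t K' "(x t0, t0)"]
  by (auto simp: contains_past_def)

text \<open>The triangle of \<open>J s\<close> at an intermediate time lies in the triangle of
  \<open>J t\<close> by nesting and in that of the past gap, so these two meet.\<close>

lemma nested_gap_triangles_contains_past:
  assumes "nested_gap_triangles f \<phi> t0 x J" "past_gap t c d" "t0 < t"
  shows "J t = {c<..<d}"
proof -
  define s where "s = (t0 + t) / 2"
  have s: "t0 < s" "s < t" using \<open>t0 < t\<close> by (auto simp: s_def)
  have Js: "J s \<in> components (gaps f \<phi> (x s) s)" and Jt: "J t \<in> components (gaps f \<phi> (x t) t)"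
    and sub: "back_triangle f (J s) (x s) s \<subseteq> back_triangle f (J t) (x t) t"
    using assms(1) s \<open>t0 < t\<close> by (auto simp: nested_gap_triangles_def)
  obtain v where "v \<in> J s" using in_components_nonempty[OF Js] by blast
  then have p: "(chr v (x s) s (s / 2), s / 2) \<in> back_triangle f (J s) (x s) s"
    using s t0_pos by (auto simp: in_back_triangle)
  then have "(chr v (x s) s (s / 2), s / 2) \<in> back_triangle f {c<..<d} (x t) t"
    using back_triangle_component_subset[OF Js] char_triangle_subset_gap[OF assms(2), of s] s by auto
  then show ?thesis
    using component_eq_if_triangles_meet[OF Jt past_gap_component[OF assms(2,3)]] p sub by blast
qed

section \<open>Lipschitz bound and limits of the traces along the curve\<close>

definition L :: real where "L = max \<bar>a C\<bar> \<bar>a (- C)\<bar>"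

text \<open>By capture the chord slope lies between the speeds of the two traces at the later point,
  and these states lie in \<open>{- C..C}\<close>.\<close>

lemma x_lipschitz_le:
  assumes "t0 \<le> s" "s < t"
  shows "\<bar>x t - x s\<bar> \<le> L * (t - s)"
proof -
  have t: "0 < t" using assms t0_pos by simp
  have "a (- C) \<le> a (uR (x t) t)" "a (uL (x t) t) \<le> a C"
    using Mx_bounded(1)[OF t uR_in[OF t]] Mx_bounded(2)[OF t uL_in[OF t]] by simp_all
  then have "- L \<le> a (uR (x t) t)" "a (uL (x t) t) \<le> L"
    unfolding L_def by linarith+
  then have "(t - s) * - L \<le> (t - s) * a (uR (x t) t)" "(t - s) * a (uL (x t) t) \<le> (t - s) * L"
    using assms by (simp_all only: mult_le_cancel_left_pos diff_gt_0_iff_gt)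
  then show ?thesis
    using captured_past[OF assms] by (simp add: captured_def chr_def abs_le_iff mult.commute)
qed

lemma x_lipschitz: "L-lipschitz_on {t0..} x"
proof (rule lipschitz_onI)
  fix s t assume "s \<in> {t0..}" "t \<in> {t0..}"
  then show "dist (x s) (x t) \<le> L * dist s t"
    using x_lipschitz_le[of s t] x_lipschitz_le[of t s]
    by (cases s t rule: linorder_cases) (auto simp: dist_real_def abs_minus_commute)
qed (simp add: L_def)

lemma x_tendsto:
  assumes "t0 < t"
  shows "(x \<longlongrightarrow> x t) (at t within S)"
proof -
  have "continuous_on {t0<..} x" by (rule continuous_on_subset[OF x_cont]) auto
  then have "isCont x t" using assms by (simp add: continuous_on_eq_continuous_at)
  then show ?thesis unfolding continuous_at by (rule tendsto_within_subset) simp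
qed

lemma Mx_along_curve:
  assumes "t0 < t" "open U" "Mx (x t) t \<subseteq> U"
  shows "\<forall>\<^sub>F s in at t within S. Mx (x s) s \<subseteq> U"
proof -
  have "\<forall>\<^sub>F p in nhds (x t, t). Mx (fst p) (snd p) \<subseteq> U"
    using Mx_upper_hemicontinuous[OF _ assms(2,3)] assms(1) t0_pos by simp
  moreover have "filterlim (\<lambda>s. (x s, s)) (nhds (x t, t)) (at t within S)"
    by (intro tendsto_intros x_tendsto assms)
  ultimately show ?thesis using eventually_compose_filterlim by fastforce
qed

text \<open>The upper bound is upper hemicontinuity; the lower bound comes from nested triangles,
  compared at the fixed earlier time \<open>t / 2\<close>.\<close>

lemma trace_left_tendsto_right:
  assumes "t0 < t"
  shows "((\<lambda>s. uL (x s) s) \<longlongrightarrow> uL (x t) t) (at_right t)"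
proof (rule order_tendstoI)
  have t: "0 < t" using assms t0_pos by simp
  fix l assume "uL (x t) t < l"
  then have "Mx (x t) t \<subseteq> {..<l}" using uL_ge[OF t, of _ "x t"] by fastforce
  then have "\<forall>\<^sub>F s in at_right t. Mx (x s) s \<subseteq> {..<l}" using Mx_along_curve assms by simp
  then show "\<forall>\<^sub>F s in at_right t. uL (x s) s < l"
    using eventually_at_right_less[of t]
  proof eventually_elim
    case (elim s)
    then have "uL (x s) s \<in> Mx (x s) s" using uL_in t by simp
    then show ?case using elim by auto
  qed
next
  fix l assume l: "l < uL (x t) t"
  have t: "0 < t" using assms t0_pos by simp
  \<comment> \<open>The speed of the line to \<open>(x s, s)\<close> from the point at time
    \<open>t / 2\<close> on the left edge of the triangle of \<open>(x t, t)\<close>.\<close>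
  let ?q = "\<lambda>s. (x s - x t + t / 2 * a (uL (x t) t)) / (s - t / 2)"
  have "(?q \<longlongrightarrow> (x t - x t + t / 2 * a (uL (x t) t)) / (t - t / 2)) (at_right t)"
    by (intro tendsto_intros x_tendsto assms) (use t in simp)
  then have "(?q \<longlongrightarrow> a (uL (x t) t)) (at_right t)" using t by (simp add: field_simps)
  moreover have "a l < a (uL (x t) t)" using l by simp
  ultimately have "\<forall>\<^sub>F s in at_right t. a l < ?q s" by (rule order_tendstoD)
  then show "\<forall>\<^sub>F s in at_right t. l < uL (x s) s"
    using eventually_at_right_less[of t]
  proof eventually_elim
    case (elim s)
    have "chr (uL (x s) s) (x s) s (t / 2) \<le> chr (uL (x t) t) (x t) t (t / 2)"
      using triangle_nested(1)[OF captured_past[of t s], of "t / 2"] elim assms t by simp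
    then have "?q s \<le> a (uL (x s) s)" using elim t by (simp add: chr_def field_simps)
    then have "a l < a (uL (x s) s)" using elim by linarith
    then show ?case by simp
  qed
qed

lemma trace_right_tendsto_right:
  assumes "t0 < t"
  shows "((\<lambda>s. uR (x s) s) \<longlongrightarrow> uR (x t) t) (at_right t)"
proof (rule order_tendstoI)
  have t: "0 < t" using assms t0_pos by simp
  fix l assume "l < uR (x t) t"
  then have "Mx (x t) t \<subseteq> {l<..}" using uR_le[OF t, of _ "x t"] by fastforce
  then have "\<forall>\<^sub>F s in at_right t. Mx (x s) s \<subseteq> {l<..}" using Mx_along_curve assms by simp
  then show "\<forall>\<^sub>F s in at_right t. l < uR (x s) s"
    using eventually_at_right_less[of t]
  proof eventually_elim
    case (elim s)
    then have "uR (x s) s \<in> Mx (x s) s" using uR_in t by simp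
    then show ?case using elim by auto
  qed
next
  fix l assume l: "uR (x t) t < l"
  have t: "0 < t" using assms t0_pos by simp
  let ?q = "\<lambda>s. (x s - x t + t / 2 * a (uR (x t) t)) / (s - t / 2)"
  have "(?q \<longlongrightarrow> (x t - x t + t / 2 * a (uR (x t) t)) / (t - t / 2)) (at_right t)"
    by (intro tendsto_intros x_tendsto assms) (use t in simp)
  then have "(?q \<longlongrightarrow> a (uR (x t) t)) (at_right t)" using t by (simp add: field_simps)
  moreover have "a (uR (x t) t) < a l" using l by simp
  ultimately have "\<forall>\<^sub>F s in at_right t. ?q s < a l" by (rule order_tendstoD)
  then show "\<forall>\<^sub>F s in at_right t. uR (x s) s < l"
    using eventually_at_right_less[of t]
  proof eventually_elim
    case (elim s)
    have "chr (uR (x t) t) (x t) t (t / 2) \<le> chr (uR (x s) s) (x s) s (t / 2)"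
      using triangle_nested(2)[OF captured_past[of t s], of "t / 2"] elim assms t by simp
    then have "a (uR (x s) s) \<le> ?q s" using elim t by (simp add: chr_def field_simps)
    then have "a (uR (x s) s) < a l" using elim by linarith
    then show ?case by simp
  qed
qed

lemma slope_to_start_tendsto:
  assumes "t0 < t"
  shows "((\<lambda>s. (x s - x t0) / (s - t0)) \<longlongrightarrow> (x t - x t0) / (t - t0)) (at_left t)"
  by (intro tendsto_intros x_tendsto assms) (use assms in simp)

lemma eventually_between_left:
  assumes "t0 < (t :: real)"
  shows "\<forall>\<^sub>F s in at_left t. t0 < s \<and> s < t"
  using eventually_at_left_real[OF assms] by (auto elim: eventually_mono)

text \<open>Seen from \<open>(x s, s)\<close>, the characteristics of minimizers hit time
  \<open>t0\<close> between the edges of the gap triangle. The speeds of the lines joining those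
  edge points to \<open>(x s, s)\<close> tend to \<open>a c\<close> and \<open>a d\<close>.\<close>

lemma Mx_in_gap_range:
  assumes gap: "past_gap t c d" and "t0 < t" "k < c" "d < l"
  shows "\<forall>\<^sub>F s in at_left t. Mx (x s) s \<subseteq> {k<..<l}"
proof -
  have lim: "((\<lambda>s. (x s - x t + (t - t0) * a v) / (s - t0)) \<longlongrightarrow> a v) (at_left t)" for v
  proof -
    have "((\<lambda>s. (x s - x t + (t - t0) * a v) / (s - t0)) \<longlongrightarrow> (x t - x t + (t - t0) * a v) / (t - t0)) (at_left t)"
      by (intro tendsto_intros x_tendsto assms) (use assms in simp)
    then show ?thesis using assms by simp
  qed
  have "a k < a c" "a d < a l" using assms by simp_all
  with order_tendstoD(1)[OF lim[of c]] order_tendstoD(2)[OF lim[of d]]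
  have "\<forall>\<^sub>F s in at_left t. a k < (x s - x t + (t - t0) * a c) / (s - t0)"
    "\<forall>\<^sub>F s in at_left t. (x s - x t + (t - t0) * a d) / (s - t0) < a l" by blast+
  then show ?thesis using eventually_between_left[OF \<open>t0 < t\<close>]
  proof eventually_elim
    case (elim s)
    show ?case
    proof
      fix v assume "v \<in> Mx (x s) s"
      then have "chr d (x t) t t0 < chr v (x s) s t0" "chr v (x s) s t0 < chr c (x t) t t0"
        using chr_in_past_gap[OF gap, of s t0 v] elim t0_pos by simp_all
      then have "a v < (x s - x t + (t - t0) * a d) / (s - t0)" "(x s - x t + (t - t0) * a c) / (s - t0) < a v"
        using elim by (simp_all add: chr_def field_simps)
      then have "a v < a l" "a k < a v" using elim by linarith+
      then show "v \<in> {k<..<l}" by simp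
    qed
  qed
qed

text \<open>Near \<open>t\<close> the minimizers must avoid any compact part of the gap, while the triangle still
  has to contain the initial point, which keeps the two traces on different sides of the gap.\<close>

lemma traces_tendsto_left:
  assumes gap: "past_gap t c d" and "t0 < t"
  shows "((\<lambda>s. uL (x s) s) \<longlongrightarrow> d) (at_left t)" "((\<lambda>s. uR (x s) s) \<longlongrightarrow> c) (at_left t)"
proof -
  note ev = eventually_between_left[OF \<open>t0 < t\<close>]
  have "chr d (x t) t t0 < x t0" "x t0 < chr c (x t) t t0"
    using gap \<open>t0 < t\<close> by (auto simp: past_gap_def)
  then have "a c < (x t - x t0) / (t - t0)" "(x t - x t0) / (t - t0) < a d"
    using \<open>t0 < t\<close> by (simp_all add: chr_def field_simps)
  then obtain w where w: "c < w" "w < d" "a w = (x t - x t0) / (t - t0)"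
    by (rule a_IVT_strict)
  note slope = slope_to_start_tendsto[OF \<open>t0 < t\<close>, folded w(3)]
  have avoid: "\<forall>\<^sub>F s in at_left t. Mx (x s) s \<subseteq> - {p..q}" if "c < p" "q < d" for p q
  proof (rule Mx_along_curve[OF \<open>t0 < t\<close>])
    have "{p..q} \<subseteq> {c<..<d}" using that by auto
    then show "Mx (x t) t \<subseteq> - {p..q}" using gap by (auto simp: past_gap_def)
  qed (simp add: open_Compl)
  have mem: "uL (x s) s \<in> Mx (x s) s" "uR (x s) s \<in> Mx (x s) s" if "t0 < s" for s
    using uL_in uR_in that t0_pos by simp_all
  show "((\<lambda>s. uL (x s) s) \<longlongrightarrow> d) (at_left t)"
  proof (rule order_tendstoI)
    fix l assume "d < l"
    show "\<forall>\<^sub>F s in at_left t. uL (x s) s < l"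
      \<comment> \<open>The value \<open>c - 1\<close> stands for any bound below \<open>c\<close>;
        only the upper bound matters here.\<close>
      using Mx_in_gap_range[OF gap \<open>t0 < t\<close> _ \<open>d < l\<close>, of "c - 1", simplified] ev
      by eventually_elim (use mem(1) in fastforce)
  next
    fix l assume "l < d"
    \<comment> \<open>Capture of the initial point pushes \<open>uL\<close> above \<open>p\<close>;
      as the minimizers avoid \<open>{p..l}\<close>, it is then above \<open>l\<close>.\<close>
    obtain p where p: "c < p" "p < w" using w dense by blast
    then have "a p < a w" by simp
    from order_tendstoD(1)[OF slope this] avoid[OF p(1) \<open>l < d\<close>] ev
    show "\<forall>\<^sub>F s in at_left t. l < uL (x s) s"
    proof eventually_elim
      case (elim s)
      have "chr (uL (x s) s) (x s) s t0 \<le> x t0"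
        using captured_past[of t0 s] elim by (simp add: captured_def)
      then have "(x s - x t0) / (s - t0) \<le> a (uL (x s) s)"
        using elim by (simp add: chr_def field_simps)
      then have "a p < a (uL (x s) s)" using elim by linarith
      moreover have "uL (x s) s \<notin> {p..l}" using mem(1)[of s] elim by blast
      ultimately show ?case by auto
    qed
  qed
  show "((\<lambda>s. uR (x s) s) \<longlongrightarrow> c) (at_left t)"
  proof (rule order_tendstoI)
    fix l assume "l < c"
    show "\<forall>\<^sub>F s in at_left t. l < uR (x s) s"
      using Mx_in_gap_range[OF gap \<open>t0 < t\<close> \<open>l < c\<close>, of "d + 1", simplified] ev
      by eventually_elim (use mem(2) in fastforce)
  next
    fix l assume "c < l"
    obtain p where p: "w < p" "p < d" using w dense by blast
    then have "a w < a p" by simp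
    from order_tendstoD(2)[OF slope this] avoid[OF \<open>c < l\<close> p(2)] ev
    show "\<forall>\<^sub>F s in at_left t. uR (x s) s < l"
    proof eventually_elim
      case (elim s)
      have "x t0 \<le> chr (uR (x s) s) (x s) s t0"
        using captured_past[of t0 s] elim by (simp add: captured_def)
      then have "a (uR (x s) s) \<le> (x s - x t0) / (s - t0)"
        using elim by (simp add: chr_def field_simps)
      then have "a (uR (x s) s) < a p" using elim by linarith
      moreover have "uR (x s) s \<notin> {l..p}" using mem(2)[of s] elim by blast
      ultimately show ?case by auto
    qed
  qed
qed

section \<open>One-sided derivatives and the exceptional times\<close>

text \<open>The set \<open>S\<close> is left free so that one statement serves both sides, each with
  its own limits of the traces.\<close>

lemma shock_derivative:
  assumes "t0 < t" "u1 \<in> Mx (x t) t" "u2 \<in> Mx (x t) t" "u2 < u1"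
    and lim: "((\<lambda>s. uL (x s) s) \<longlongrightarrow> u1) (at t within S)" "((\<lambda>s. uR (x s) s) \<longlongrightarrow> u2) (at t within S)"
  shows "(x has_real_derivative (f u1 - f u2) / (u1 - u2)) (at t within S)"
proof -
  have ev: "\<forall>\<^sub>F s in at t within S. t0 < s"
    using order_tendstoD(1)[OF tendsto_ident_at \<open>t0 < t\<close>] .
  have "((\<lambda>s. (x s - x t) / (s - t)) \<longlongrightarrow> (f u1 - f u2) / (u1 - u2)) (at t within S)"
  proof (rule Rankine_Hugoniot[OF _ assms(2-4) x_tendsto[OF \<open>t0 < t\<close>] tendsto_ident_at lim, of L])
    show "0 < t" using assms t0_pos by simp
    show "\<forall>\<^sub>F s in at t within S. uL (x s) s \<in> Mx (x s) s" "\<forall>\<^sub>F s in at t within S. uR (x s) s \<in> Mx (x s) s"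
      using ev t0_pos by (auto elim!: eventually_mono intro!: uL_in uR_in)
    show "\<forall>\<^sub>F s in at t within S. s \<noteq> t" by (simp add: eventually_at_filter)
    show "\<forall>\<^sub>F s in at t within S. \<bar>x s - x t\<bar> \<le> L * \<bar>s - t\<bar>"
      using ev
    proof eventually_elim
      case (elim s)
      then show ?case
        using lipschitz_onD[OF x_lipschitz, of s t] assms(1) by (simp add: dist_real_def)
    qed
    show "0 \<le> L" by (simp add: L_def)
  qed
  then show ?thesis by (simp add: has_field_derivative_iff)
qed

lemma right_derivative:
  assumes "t0 < t"
  shows "(x has_real_derivative (f (uL (x t) t) - f (uR (x t) t)) / (uL (x t) t - uR (x t) t)) (at_right t)"
  using assms t0_pos
  by (intro shock_derivative trace_left_tendsto_right trace_right_tendsto_right jump uL_in uR_in) auto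

lemma left_derivative:
  assumes "past_gap t c d" "t0 < t"
  shows "(x has_real_derivative (f d - f c) / (d - c)) (at_left t)"
  using assms(1) by (intro shock_derivative traces_tendsto_left assms) (auto simp: past_gap_def)

text \<open>A time at which the triangle of the gap is a proper part of the characteristic triangle
  is charged to the remainder, cut at the fixed time \<open>t0 / 2\<close>; later gap triangles contain the
  earlier characteristic triangles, so these remainders are disjoint.\<close>

lemma countable_kinks:
  assumes gap: "\<And>t. t0 < t \<Longrightarrow> past_gap t (c t) (d t)"
  shows "countable {t. t0 < t \<and> d t < uL (x t) t}" "countable {t. t0 < t \<and> uR (x t) t < c t}"
proof -
  define h where "h = t0 / 2"
  have h: "0 < h" "h < t0" using t0_pos by (auto simp: h_def)
  have mem: "uL (x s) s \<in> Mx (x s) s" "uR (x s) s \<in> Mx (x s) s" if "t0 < s" for s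
    using uL_in uR_in that t0_pos by simp_all
  have gap_mem: "c s \<in> Mx (x s) s" "d s \<in> Mx (x s) s" if "t0 < s" for s
    using gap[OF that] by (auto simp: past_gap_def)
  have later: "chr (d t) (x t) t h < chr v (x s) s h" "chr v (x s) s h < chr (c t) (x t) t h"
    if "t0 < s" "s < t" "v \<in> Mx (x s) s" for s t v
    using chr_in_past_gap[OF gap, of t s h v] that h by auto
  show "countable {t. t0 < t \<and> d t < uL (x t) t}"
  proof (rule countable_disjoint_intervals)
    show "chr (uL (x t) t) (x t) t h < chr (d t) (x t) t h" if "t \<in> {t. t0 < t \<and> d t < uL (x t) t}" for t
      using that h by (auto simp: chr_less_iff)
    fix s t assume st: "s \<in> {t. t0 < t \<and> d t < uL (x t) t}" "t \<in> {t. t0 < t \<and> d t < uL (x t) t}" "s \<noteq> t"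
    have "chr (d t) (x t) t h < chr (uL (x s) s) (x s) s h \<or> chr (d s) (x s) s h < chr (uL (x t) t) (x t) t h"
      using later(1)[of s t] later(1)[of t s] mem st by (auto simp: neq_iff)
    then show "{chr (uL (x s) s) (x s) s h<..<chr (d s) (x s) s h} \<inter>
      {chr (uL (x t) t) (x t) t h<..<chr (d t) (x t) t h} = {}" by auto
  qed
  show "countable {t. t0 < t \<and> uR (x t) t < c t}"
  proof (rule countable_disjoint_intervals)
    show "chr (c t) (x t) t h < chr (uR (x t) t) (x t) t h" if "t \<in> {t. t0 < t \<and> uR (x t) t < c t}" for t
      using that h by (auto simp: chr_less_iff)
    fix s t assume st: "s \<in> {t. t0 < t \<and> uR (x t) t < c t}" "t \<in> {t. t0 < t \<and> uR (x t) t < c t}" "s \<noteq> t"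
    have "chr (uR (x s) s) (x s) s h < chr (c t) (x t) t h \<or> chr (uR (x t) t) (x t) t h < chr (c s) (x s) s h"
      using later(2)[of s t] later(2)[of t s] mem st by (auto simp: neq_iff)
    then show "{chr (c s) (x s) s h<..<chr (uR (x s) s) (x s) s h} \<inter>
      {chr (c t) (x t) t h<..<chr (uR (x t) t) (x t) t h} = {}" by auto
  qed
qed

text \<open>If the selected gap fills the whole state interval, the two slope formulas coincide;
  otherwise an end of the gap misses a trace, which \<open>countable_kinks\<close> allows only
  countably often.\<close>

lemma countable_derivative_jumps:
  "countable {t. t0 < t \<and> \<not> (\<exists>D. (x has_real_derivative D) (at_right t) \<and> (x has_real_derivative D) (at_left t))}"
proof -
  have "\<exists>c d. past_gap t c d" if "t0 < t" for t
    using past_gap_exists[OF that] by blast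
  then obtain c d where gap: "\<And>t. t0 < t \<Longrightarrow> past_gap t (c t) (d t)"
    by metis
  have "\<exists>D. (x has_real_derivative D) (at_right t) \<and> (x has_real_derivative D) (at_left t)"
    if t: "t0 < t" "\<not> d t < uL (x t) t" "\<not> uR (x t) t < c t" for t
  proof -
    have "d t = uL (x t) t" "c t = uR (x t) t"
      using gap[OF t(1)] uL_ge[of t "d t" "x t"] uR_le[of t "c t" "x t"] t t0_pos by (auto simp: past_gap_def)
    then show ?thesis using left_derivative[OF gap[OF t(1)] t(1)] right_derivative[OF t(1)] by auto
  qed
  then show ?thesis
    by (intro countable_subset[OF _ countable_Un[OF countable_kinks[OF gap]]]) blast+
qed

end

theorem theorem5p5:
  fixes f \<phi> x :: "real \<Rightarrow> real" and x0 t0 :: real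
  assumes f_diff: "\<And>s. f differentiable (at s)"
    and f'_diff: "\<And>s. deriv f differentiable (at s)"
    and f''_cont: "continuous_on UNIV (deriv (deriv f))"
    and f''_nonneg: "\<And>s. 0 \<le> deriv (deriv f) s"
    and f''_null: "{s. deriv (deriv f) s = 0} \<in> null_sets lebesgue"
    and \<phi>_meas: "\<phi> \<in> borel_measurable lebesgue"
    and \<phi>_bdd: "\<exists>C. AE y in lebesgue. \<bar>\<phi> y\<bar> \<le> C"
    and t0_pos: "0 < t0"
    and x_start: "x t0 = x0"
    and x_cont: "continuous_on {t0..} x"
    and x_disc: "discontinuous_along f \<phi> t0 x"
  shows "forward_generalized_characteristic f \<phi> x0 t0 x \<and>
    (\<exists>J. nested_gap_triangles f \<phi> t0 x J \<and>
      (\<forall>K\<in>components (gaps f \<phi> x0 t0). \<forall>t>t0.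
         back_triangle f K x0 t0 \<subseteq> back_triangle f (J t) (x t) t) \<and>
      (\<forall>J'. nested_gap_triangles f \<phi> t0 x J' \<longrightarrow> (\<forall>t>t0. J' t = J t)) \<and>
      lipschitz_shock f \<phi> t0 x \<and>
      (\<forall>t>t0. (x has_real_derivative
          (f (trace_left f \<phi> (x t) t) - f (trace_right f \<phi> (x t) t)) /
          (trace_left f \<phi> (x t) t - trace_right f \<phi> (x t) t)) (at_right t)) \<and>
      (\<forall>t>t0. \<exists>c d. c < d \<and> J t = {c<..<d} \<and>
          contains_past f \<phi> t0 x t {c<..<d} \<and>
          (\<forall>K. contains_past f \<phi> t0 x t K \<longrightarrow> K = {c<..<d}) \<and>
          (x has_real_derivative (f d - f c) / (d - c)) (at_left t)) \<and>
      countable {t. t0 < t \<and>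
          \<not> (\<exists>D. (x has_real_derivative D) (at_right t) \<and>
                 (x has_real_derivative D) (at_left t))})"
proof -
  obtain C where C: "AE y in lebesgue. \<bar>\<phi> y\<bar> \<le> C" using \<phi>_bdd by blast
  obtain \<Phi> where int: "\<And>p q. \<phi> absolutely_integrable_on {p<..<q}"
    and \<Phi>: "\<And>p q. p \<le> q \<Longrightarrow> integral {p<..<q} \<phi> = \<Phi> q - \<Phi> p"
    and lip: "\<And>p q. \<bar>\<Phi> p - \<Phi> q\<bar> \<le> C * \<bar>p - q\<bar>"
    using AE_bounded_primitive[OF \<phi>_meas C] by blast
  have mono: "strict_mono (deriv f)"
    by (rule strict_mono_if_deriv_null[OF f'_diff f''_nonneg f''_null])
  interpret shock_curve f \<phi> \<Phi> C x t0
  proof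
    show "(f has_real_derivative deriv f s) (at s)" for s
      using f_diff by (simp add: DERIV_deriv_iff_real_differentiable)
    show "continuous_on UNIV (deriv f)"
      using f'_diff by (intro continuous_at_imp_continuous_on ballI differentiable_imp_continuous_within)
    show "maximizers f \<phi> y t = {u. \<forall>v. \<Phi> (y - t * deriv f u) + t * (u * deriv f u - f u)
        \<le> \<Phi> (y - t * deriv f v) + t * (v * deriv f v - f v)}" if "0 < t" for y t
    proof -
      \<comment> \<open>The first bracket does not depend on \<open>w\<close>, so comparing values
        of \<open>E\<close> reverses the comparison of costs.\<close>
      have E: "E f \<phi> w y t = (\<Phi> (y - t * deriv f 0) - t * f 0)
          - (\<Phi> (y - t * deriv f w) + t * (w * deriv f w - f w))" for w
        by (rule E_eq_cost_difference[OF f_diff f'_diff f''_cont f''_nonneg mono int \<Phi> that])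
      show ?thesis unfolding maximizers_def E by (intro Collect_cong all_cong1) linarith
    qed
  qed (rule mono lip t0_pos x_cont x_disc)+
  have "\<exists>c d. past_gap t c d" if "t0 < t" for t
    using past_gap_exists[OF that] by blast
  then obtain c d where gap: "\<And>t. t0 < t \<Longrightarrow> past_gap t (c t) (d t)"
    by metis
  define J where "J t = {c t<..<d t}" for t
  show ?thesis
  proof (intro conjI exI[of _ J] ballI allI impI)
    show "forward_generalized_characteristic f \<phi> x0 t0 x"
      using forward_characteristic x_start by simp
    show "nested_gap_triangles f \<phi> t0 x J"
      unfolding nested_gap_triangles_def J_def
    proof (intro conjI allI impI)
      show "{c t<..<d t} \<in> components (gaps f \<phi> (x t) t)" if "t0 < t" for t
        using past_gap_component gap that by blast
      \<comment> \<open>The inclusion passes through the characteristic triangle of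
        \<open>(x s, s)\<close>.\<close>
      show "back_triangle f {c s<..<d s} (x s) s \<subseteq> back_triangle f {c t<..<d t} (x t) t"
        if "t0 < s \<and> s < t" for s t
        using back_triangle_component_subset[OF past_gap_component[OF gap, of s]]
          char_triangle_subset_gap[OF gap, of t s] that by simp
    qed
    \<comment> \<open>All components at the initial point are absorbed into the same later gap
      triangle.\<close>
    show "back_triangle f K x0 t0 \<subseteq> back_triangle f (J t) (x t) t"
      if "K \<in> components (gaps f \<phi> x0 t0)" "t0 < t" for K t
      using back_triangle_component_subset[OF that(1)] char_triangle_subset_gap[OF gap[OF that(2)], of t0]
        x_start that(2) by (simp add: J_def)
    show "J' t = J t" if "nested_gap_triangles f \<phi> t0 x J'" "t0 < t" for J' t
      using nested_gap_triangles_contains_past gap that by (simp add: J_def)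
    show "lipschitz_shock f \<phi> t0 x"
      using x_lipschitz x_disc by (auto simp: lipschitz_shock_def)
    show "(x has_real_derivative (f (trace_left f \<phi> (x t) t) - f (trace_right f \<phi> (x t) t)) /
        (trace_left f \<phi> (x t) t - trace_right f \<phi> (x t) t)) (at_right t)" if "t0 < t" for t
      using right_derivative that by blast
    show "\<exists>c d. c < d \<and> J t = {c<..<d} \<and> contains_past f \<phi> t0 x t {c<..<d} \<and>
        (\<forall>K. contains_past f \<phi> t0 x t K \<longrightarrow> K = {c<..<d}) \<and>
        (x has_real_derivative (f d - f c) / (d - c)) (at_left t)" if "t0 < t" for t
    proof (intro exI conjI allI impI)
      show "c t < d t" using gap[OF that] by (simp add: past_gap_def)
      show "J t = {c t<..<d t}" by (simp add: J_def)
      show past: "contains_past f \<phi> t0 x t {c t<..<d t}"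
        using past_gap_contains_past gap that by blast
      show "K = {c t<..<d t}" if K: "contains_past f \<phi> t0 x t K" for K
        using contains_past_unique[OF K past \<open>t0 < t\<close>] .
      show "(x has_real_derivative (f (d t) - f (c t)) / (d t - c t)) (at_left t)"
        using left_derivative gap that by blast
    qed
  qed (rule countable_derivative_jumps)
qed

end
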